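(* Let $N$ be an even positive integer, let $J_{i,j}\in\mathbb{R}$ ($i,j=1,\dots,N$) and $B\in\mathbb{R}$, and let $$\hat H=\sum_{i,j=1}^N J_{i,j}\,\hat\sigma_z^i\hat\sigma_z^j+B\sum_{i=1}^N\hat\sigma_x^i$$ act on $(\mathbb{C}^2)^{\otimes N}$. Suppose that $\hat H$ has a non-degenerate ground state $|\psi\rangle$ (normalized), and that the couplings satisfy $J_{i,j}=J_{N+1-i,N+1-j}$ for all $i,j$. Let $\mathcal{J}$ be the $\frac N2\times\frac N2$ matrix with entries $\mathcal{J}_{i,j}=J_{i,N+1-j}$, $i,j=1,\dots,\frac N2$. If $\mathcal{J}$ is negative semi-definite, then $$E_{\text{l.n.}}(|\psi\rangle\langle\psi|)=\log_2\operatorname{tr}\bigl[|\Phi\rangle\langle\Phi|\,|\psi\rangle\langle\psi|\bigr].$$ If $\mathcal{J}$ is positive semi-definite, then $$E_{\text{l.n.}}(|\psi\rangle\langle\psi|)=\log_2\operatorname{tr}\bigl[|\Phi'\rangle\langle\Phi'|\,|\psi\rangle\langle\psi|\bigr],$$ where $|\Phi'\rangle=\hat\sigma_x^1\otimes\cdots\otimes\hat\sigma_x^{N/2}\,|\Phi\rangle$.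
   Context: The system consists of $N$ spins-1/2 (qubits), with computational basis $|0\rangle,|1\rangle$ of each $\mathbb{C}^2$. $\hat\sigma_x^i,\hat\sigma_z^i$ denote the Pauli matrices acting on the $i$-th tensor factor (and as the identity on the others), with $\hat\sigma_z$ diagonal in the computational basis. A non-degenerate ground state is a unit eigenvector for the smallest eigenvalue, when that eigenvalue is simple. The bipartition is $A=\{1,\dots,\frac N2\}$ versus $B=\{\frac N2+1,\dots,N\}$. The logarithmic negativity of a density matrix $\hat\varrho$ is $E_{\text{l.n.}}(\hat\varrho)=\log_2\|\hat\varrho^{\Gamma}\|_1$, where $\hat\varrho^\Gamma$ is the partial transpose of $\hat\varrho$ (in the computational basis) with respect to the bipartition $A|B$ and $\|\hat X\|_1=\operatorname{tr}|\hat X|$ is the trace norm. The vector $|\Phi\rangle$ is the un-normalized maximally entangled state $$|\Phi\rangle=2^{N/4}\bigotimes_{i=1}^{N/2}|\phi\rangle_{i,N+1-i},\qquad |\phi\rangle_{i,j}=\frac{|00\rangle+|11\rangle}{\sqrt2},$$ where $|\phi\rangle_{i,j}$ is a state of spins $i$ and $j$. *)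

theory Defs
  imports Complex_Main "Jordan_Normal_Form.Schur_Decomposition"
begin

text \<open>
  The computational basis of (C^2)^{\<otimes>N} is indexed by s < 2^N, where the spins
  are numbered 1, \<dots>, N and spin i is the i-th binary digit of s,
  counted from the most significant one (the usual ordering of the Kronecker product).
\<close>

definition spin :: "nat \<Rightarrow> nat \<Rightarrow> nat \<Rightarrow> nat" where
  "spin N i s = (s div 2 ^ (N - i)) mod 2"

definition pauli_x :: "complex mat" where
  "pauli_x = mat_of_rows_list 2 [[0, 1], [1, 0]]"

definition pauli_z :: "complex mat" where
  "pauli_z = mat_of_rows_list 2 [[1, 0], [0, - 1]]"

definition tensor_op :: "nat \<Rightarrow> (nat \<Rightarrow> complex mat) \<Rightarrow> complex mat" where
  "tensor_op N M = mat (2 ^ N) (2 ^ N) (\<lambda>(s, t). \<Prod>i = 1..N. M i $$ (spin N i s, spin N i t))"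

definition site_op :: "nat \<Rightarrow> complex mat \<Rightarrow> nat \<Rightarrow> complex mat" where
  "site_op N M i = tensor_op N (\<lambda>k. if k = i then M else 1\<^sub>m 2)"

text \<open>The type of matrices is not a monoid (dimensions vary), so finite sums are taken entrywise.\<close>

definition mat_sum :: "nat \<Rightarrow> ('i \<Rightarrow> complex mat) \<Rightarrow> 'i set \<Rightarrow> complex mat" where
  "mat_sum d F I = mat d d (\<lambda>st. \<Sum>k\<in>I. F k $$ st)"

definition ising_hamiltonian :: "nat \<Rightarrow> (nat \<Rightarrow> nat \<Rightarrow> real) \<Rightarrow> real \<Rightarrow> complex mat" where
  "ising_hamiltonian N J B =
     mat_sum (2 ^ N)
       (\<lambda>(i, j). complex_of_real (J i j) \<cdot>\<^sub>m (site_op N pauli_z i * site_op N pauli_z j))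
       ({1..N} \<times> {1..N})
     + complex_of_real B \<cdot>\<^sub>m mat_sum (2 ^ N) (site_op N pauli_x) {1..N}"

text \<open>
  Meant for Hermitian H, whose eigenvalues are all real. Non-degeneracy says that the
  eigenspace of the smallest eigenvalue is the line spanned by \<psi>.
\<close>

definition nondegenerate_ground_state :: "complex mat \<Rightarrow> complex vec \<Rightarrow> bool" where
  "nondegenerate_ground_state H \<psi> \<longleftrightarrow>
     \<psi> \<bullet>c \<psi> = 1 \<and>
     (\<exists>E :: real.
        eigenvector H \<psi> (complex_of_real E) \<and>
        (\<forall>e :: real. eigenvalue H (complex_of_real e) \<longrightarrow> E \<le> e) \<and>
        (\<forall>\<phi>. eigenvector H \<phi> (complex_of_real E) \<longrightarrow> (\<exists>c. \<phi> = c \<cdot>\<^sub>v \<psi>)))"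

text \<open>
  On the complex numbers, 0 \<le> z means that z is real and non-negative, so a complex
  positive semi-definite matrix is Hermitian. On the reals this is non-negativity of the quadratic
  form; symmetry of the matrix is not required.
\<close>

definition pos_semidef :: "'a :: conjugatable_ordered_field mat \<Rightarrow> bool" where
  "pos_semidef A \<longleftrightarrow> square_mat A \<and> (\<forall>v \<in> carrier_vec (dim_row A). 0 \<le> (A *\<^sub>v v) \<bullet>c v)"

definition neg_semidef :: "'a :: conjugatable_ordered_field mat \<Rightarrow> bool" where
  "neg_semidef A \<longleftrightarrow> square_mat A \<and> (\<forall>v \<in> carrier_vec (dim_row A). (A *\<^sub>v v) \<bullet>c v \<le> 0)"

definition mat_trace :: "'a :: comm_monoid_add mat \<Rightarrow> 'a" where
  "mat_trace A = (\<Sum>i < dim_row A. A $$ (i, i))"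

text \<open>The modulus |X| is the positive semi-definite square root of X* X, with X* the adjoint of X.\<close>

definition mat_abs :: "complex mat \<Rightarrow> complex mat" where
  "mat_abs X = (THE P. P \<in> carrier_mat (dim_col X) (dim_col X) \<and> pos_semidef P \<and>
                       P * P = mat_adjoint X * X)"

definition trace_norm :: "complex mat \<Rightarrow> real" where
  "trace_norm X = Re (mat_trace (mat_abs X))"

text \<open>The basis index whose spins in A are those of s and whose other spins are
  those of t.\<close>

definition splice_index :: "nat \<Rightarrow> nat set \<Rightarrow> nat \<Rightarrow> nat \<Rightarrow> nat" where
  "splice_index N A s t = (\<Sum>i = 1..N. (if i \<in> A then spin N i s else spin N i t) * 2 ^ (N - i))"

text \<open>The transposition acts on the tensor factors in A.\<close>

definition partial_transpose :: "nat \<Rightarrow> nat set \<Rightarrow> complex mat \<Rightarrow> complex mat" where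
  "partial_transpose N A \<rho> =
     mat (2 ^ N) (2 ^ N) (\<lambda>(s, t). \<rho> $$ (splice_index N A t s, splice_index N A s t))"

definition log_negativity :: "nat \<Rightarrow> complex mat \<Rightarrow> real" where
  "log_negativity N \<rho> = log 2 (trace_norm (partial_transpose N {1..N div 2} \<rho>))"

definition ket_bra :: "complex vec \<Rightarrow> complex vec \<Rightarrow> complex mat" where
  "ket_bra v w = mat (dim_vec v) (dim_vec w) (\<lambda>(s, t). v $ s * cnj (w $ t))"

text \<open>The amplitudes of (|00\<rangle> + |11\<rangle>) / \<surd>2 in the computational basis of two spins.\<close>

definition bell :: "nat \<Rightarrow> nat \<Rightarrow> complex" where
  "bell a b = (if a = b then complex_of_real (1 / sqrt 2) else 0)"

definition Phi :: "nat \<Rightarrow> complex vec" where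
  "Phi N = complex_of_real (2 powr (real N / 4)) \<cdot>\<^sub>v
     vec (2 ^ N) (\<lambda>s. \<Prod>i = 1..N div 2. bell (spin N i s) (spin N (N + 1 - i) s))"

definition Phi' :: "nat \<Rightarrow> complex vec" where
  "Phi' N = tensor_op N (\<lambda>i. if i \<le> N div 2 then pauli_x else 1\<^sub>m 2) *\<^sub>v Phi N"

text \<open>Matrix indices start at 0: the entry at (i, j) is
  J (i + 1) (N + 1 - (j + 1)).\<close>

definition cross_coupling :: "nat \<Rightarrow> (nat \<Rightarrow> nat \<Rightarrow> real) \<Rightarrow> real mat" where
  "cross_coupling N J = mat (N div 2) (N div 2) (\<lambda>(i, j). J (i + 1) (N - j))"

end

theory Submission
  imports Defs
begin

text \<open>
  Read the amplitudes of a state as a square matrix C whose rows are the configurations of A and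
  whose columns are the mirrored configurations of B. The Hamiltonian maps C to K C + C K minus the
  entrywise product of W and C, with K real symmetric and W a positive semi-definite pairing of the
  spins of the two halves (after flipping the spins of A when the cross coupling is positive
  semi-definite). The adjoint of C is again a ground state, so C is Hermitian up to a phase.
  Replacing its eigenvalues by their moduli preserves the K-terms and does not increase the
  interaction energy, so by uniqueness C = c P with P positive semi-definite and c of modulus 1.
  The partial transpose of the projector has modulus \<open>P \<otimes> P\<close>, both factors transposed, hence trace
  norm (tr P)^2, which is also the squared modulus of the overlap tr C with Phi.
\<close>

subsection \<open>Spectral theorem\<close>

text \<open>The mirror symmetry of \<open>J\<close> makes one real symmetric K act on both sides of
  C and makes W symmetric; this is why taking the adjoint, which exchanges the two K-terms, leaves
  the energy unchanged. Hermiticity has to come before the modulus: for a general C the K-terms see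
  the two products of C with its adjoint, whose square roots differ, whereas a Hermitian matrix has
  one eigenbasis for rows and columns and a single modulus serving both terms. In that eigenbasis
  the interaction energy is minus the sum of l_k l_k' M_kk', where M_kk' is a sum of values of the
  semi-definite coupling form and hence non-negative. Positivity here is that of a matrix and not of
  amplitudes, so \<open>B\<close> enters only through K. Flipping the spins of A reverses the terms
  that couple the halves and nothing else: a term within A contains two sigma_z, and sigma_x is
  invariant. The partial transpose of the projector differs from its modulus by the exchange of the
  two halves of one index, a unitary factor that the modulus does not see.\<close>

definition orthonormal :: "nat \<Rightarrow> (nat \<Rightarrow> nat \<Rightarrow> complex) \<Rightarrow> bool" where
  "orthonormal n u \<longleftrightarrow>
     (\<forall>k<n. \<forall>l<n. (\<Sum>i<n. cnj (u k i) * u l i) = (if k = l then 1 else 0))"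

lemma sum_cnj_mult_self:
  "(\<Sum>i\<in>I. cnj (v i) * v i) = complex_of_real (\<Sum>i\<in>I. (cmod (v i))\<^sup>2)"
  unfolding of_real_sum
  by (rule sum.cong) (simp_all add: complex_norm_square mult.commute del: of_real_power)

lemma exists_eigenvector:
  fixes A :: "nat \<Rightarrow> nat \<Rightarrow> complex"
  assumes "n > 0"
  shows "\<exists>v e. (\<Sum>i<n. cnj (v i) * v i) = 1 \<and> (\<forall>i<n. (\<Sum>j<n. A i j * v j) = e * v i)"
proof -
  define M where "M = mat n n (\<lambda>(i, j). A i j)"
  have M: "M \<in> carrier_mat n n" by (simp add: M_def)
  have "degree (char_poly M) = n" using degree_monic_char_poly[OF M] by simp
  then have "\<not> constant (poly (char_poly M))"
    using assms by (simp add: constant_degree)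
  then obtain e where "poly (char_poly M) e = 0"
    using fundamental_theorem_of_algebra by blast
  then have "eigenvalue M e" using eigenvalue_root_char_poly[OF M] by simp
  then obtain v where "eigenvector M v e" unfolding eigenvalue_def by blast
  then have v: "v \<in> carrier_vec n" "v \<noteq> 0\<^sub>v n" "M *\<^sub>v v = e \<cdot>\<^sub>v v"
    using M unfolding eigenvector_def by auto
  have ev: "(\<Sum>j<n. A i j * v $ j) = e * v $ i" if "i < n" for i
  proof -
    have "(M *\<^sub>v v) $ i = (\<Sum>j<n. A i j * v $ j)"
      using that v(1) by (simp add: M_def scalar_prod_def atLeast0LessThan)
    then show ?thesis using v that by simp
  qed
  obtain i0 where i0: "i0 < n" "v $ i0 \<noteq> 0"
    using v(1,2) by (metis carrier_vecD eq_vecI index_zero_vec(1) index_zero_vec(2))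
  define r where "r = sqrt (\<Sum>i<n. (cmod (v $ i))\<^sup>2)"
  have "0 < (\<Sum>i<n. (cmod (v $ i))\<^sup>2)"
    by (rule sum_pos2[where i = i0]) (use i0 in auto)
  then have r: "r > 0" "r\<^sup>2 = (\<Sum>i<n. (cmod (v $ i))\<^sup>2)" by (auto simp: r_def)
  have "(\<Sum>i<n. cnj (v $ i / r) * (v $ i / r)) = 1"
  proof -
    have "(\<Sum>i<n. (cmod (v $ i / r))\<^sup>2) = 1"
      using r by (simp add: norm_divide power_divide flip: sum_divide_distrib r(2))
    then show ?thesis unfolding sum_cnj_mult_self by simp
  qed
  moreover have "\<forall>i<n. (\<Sum>j<n. A i j * (v $ j / r)) = e * (v $ i / r)"
    using ev by (simp flip: sum_divide_distrib)
  ultimately show ?thesis by (intro exI[of _ "\<lambda>i. v $ i / r"] exI[of _ e]) auto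
qed

text \<open>Basis completion followed by Gram-Schmidt keeps the first vector; as \<open>v\<close> is
  already a unit vector, the final normalisation does not move it either.\<close>

lemma orthonormal_extension:
  assumes "(\<Sum>i<n. cnj (v i) * v i) = 1"
  shows "\<exists>u. orthonormal n u \<and> (\<forall>i<n. u 0 i = v i)"
proof -
  define x where "x = vec n v"
  have x: "x \<in> carrier_vec n" "x \<noteq> 0\<^sub>v n"
  proof -
    show "x \<noteq> 0\<^sub>v n"
    proof
      assume "x = 0\<^sub>v n"
      then have "v i = 0" if "i < n" for i
        using that by (metis index_vec index_zero_vec(1) x_def)
      then show False using assms by simp
    qed
  qed (simp add: x_def)
  have n: "n > 0" using assms by (cases n) auto
  interpret cof_vec_space n "TYPE(complex)" .
  define b where "b = basis_completion x"
  define ws where "ws = gram_schmidt n b"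
  from basis_completion[OF x, folded b_def]
  have dist_b: "distinct b" and indep: "\<not> lin_dep (set b)" and b: "set b \<subseteq> carrier_vec n"
    and hdb: "hd b = x" and len_b: "length b = n" by auto
  from hdb len_b n obtain vs where bv: "b = x # vs" by (cases b) auto
  from gram_schmidt_result[OF b dist_b indep refl, folded ws_def]
  have ws: "set ws \<subseteq> carrier_vec n" "corthogonal ws" "length ws = n"
    by (auto simp: len_b)
  from gram_schmidt_hd[OF x(1), of vs, folded bv] have hdws: "hd ws = x" unfolding ws_def .
  define r where "r k = sqrt (\<Sum>i<n. (cmod (ws ! k $ i))\<^sup>2)" for k
  define u where "u k i = ws ! k $ i / r k" for k i
  have ip: "(\<Sum>i<n. cnj (ws ! k $ i) * ws ! l $ i) = ws ! l \<bullet>c ws ! k" if "k < n" "l < n" for k l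
  proof -
    have "ws ! k \<in> carrier_vec n" using ws that by (simp add: subset_eq)
    then show ?thesis
      by (auto simp: scalar_prod_def atLeast0LessThan mult.commute intro!: sum.cong)
  qed
  have rr: "complex_of_real (r k) * complex_of_real (r k) = (\<Sum>i<n. cnj (ws ! k $ i) * ws ! k $ i)" for k
  proof -
    have "r k * r k = (\<Sum>i<n. (cmod (ws ! k $ i))\<^sup>2)"
      unfolding r_def by (simp add: sum_nonneg)
    then show ?thesis unfolding sum_cnj_mult_self by (metis of_real_mult)
  qed
  have orth: "(\<Sum>i<n. cnj (ws ! k $ i) * ws ! l $ i) = 0 \<longleftrightarrow> k \<noteq> l" if "k < n" "l < n" for k l
    using corthogonalD[OF ws(2), of l k] that ws(3) ip[OF that] by auto
  have "orthonormal n u"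
    unfolding orthonormal_def
  proof (intro allI impI)
    fix k l assume kl: "k < n" "l < n"
    have "(\<Sum>i<n. cnj (u k i) * u l i) = (\<Sum>i<n. cnj (ws ! k $ i) * ws ! l $ i) / (r k * r l)"
      by (simp add: u_def sum_divide_distrib)
    then show "(\<Sum>i<n. cnj (u k i) * u l i) = (if k = l then 1 else 0)"
      using orth[OF kl] rr[of k] by auto
  qed
  moreover have "u 0 i = v i" if "i < n" for i
  proof -
    have w0: "ws ! 0 = x" using hdws ws(3) n by (metis hd_conv_nth length_0_conv less_numeral_extra(3))
    have "(\<Sum>i<n. cnj (ws ! 0 $ i) * ws ! 0 $ i) = 1"
      using assms by (simp add: w0 x_def)
    then have "(\<Sum>i<n. (cmod (ws ! 0 $ i))\<^sup>2) = 1"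
      unfolding sum_cnj_mult_self by (metis of_real_eq_1_iff)
    then have "r 0 = 1" by (simp add: r_def)
    then show ?thesis using that by (simp add: u_def w0 x_def)
  qed
  ultimately show ?thesis by blast
qed

text \<open>Orthonormality says that the conjugate transpose is a left inverse. For square matrices
  it is then a right inverse, which is this completeness relation.\<close>

lemma orthonormal_complete:
  assumes "orthonormal n u" "i < n" "j < n"
  shows "(\<Sum>k<n. u k i * cnj (u k j)) = (if i = j then 1 else 0)"
proof -
  define U where "U = mat n n (\<lambda>(i, k). u k i)"
  define V where "V = mat n n (\<lambda>(k, i). cnj (u k i))"
  have c: "U \<in> carrier_mat n n" "V \<in> carrier_mat n n" by (auto simp: U_def V_def)
  have "V * U = 1\<^sub>m n"
    by (rule eq_matI)
      (use assms(1) in \<open>auto simp: U_def V_def orthonormal_def scalar_prod_def atLeast0LessThan\<close>)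
  then have "U * V = 1\<^sub>m n" using mat_mult_left_right_inverse c by blast
  then have "(U * V) $$ (i, j) = (if i = j then 1 else 0)" using assms by simp
  then show ?thesis
    using assms by (simp add: U_def V_def scalar_prod_def atLeast0LessThan)
qed

text \<open>The eigenvalue is the value of the Hermitian form at the unit vector \<open>v\<close>,
  and conjugation merely exchanges the two summation indices.\<close>

lemma hermitian_eigenvalue_real:
  assumes herm: "\<And>i j. i < n \<Longrightarrow> j < n \<Longrightarrow> A j i = cnj (A i j)"
    and "(\<Sum>i<n. cnj (v i) * v i) = 1"
    and ev: "\<And>i. i < n \<Longrightarrow> (\<Sum>j<n. A i j * v j) = e * v i"
  shows "e \<in> \<real>"
proof -
  have e: "e = (\<Sum>i<n. \<Sum>j<n. cnj (v i) * A i j * v j)"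
  proof -
    have "(\<Sum>i<n. \<Sum>j<n. cnj (v i) * A i j * v j) = (\<Sum>i<n. cnj (v i) * (e * v i))"
      by (rule sum.cong) (auto simp: ev[symmetric] sum_distrib_left mult.assoc)
    also have "\<dots> = e * (\<Sum>i<n. cnj (v i) * v i)"
      by (simp add: sum_distrib_left mult.left_commute)
    finally show ?thesis using assms(2) by simp
  qed
  have "cnj e = (\<Sum>i<n. \<Sum>j<n. cnj (v j) * A j i * v i)"
  proof -
    have "cnj (cnj (v i) * A i j * v j) = cnj (v j) * A j i * v i" if "i < n" "j < n" for i j
      using herm[OF that] by simp
    then show ?thesis by (subst e) (simp add: cnj_sum del: complex_cnj_mult)
  qed
  also have "\<dots> = e" by (subst e, rule sum.swap)
  finally show ?thesis by (simp add: Reals_cnj_iff)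
qed

lemma orthonormal_expansion:
  assumes "orthonormal n u" "i < n"
  shows "f i = (\<Sum>k<n. (\<Sum>j<n. cnj (u k j) * f j) * u k i)"
proof -
  have "(\<Sum>k<n. (\<Sum>j<n. cnj (u k j) * f j) * u k i) = (\<Sum>j<n. \<Sum>k<n. f j * (u k i * cnj (u k j)))"
    unfolding sum_distrib_right by (subst sum.swap) (simp add: mult_ac)
  also have "\<dots> = (\<Sum>j<n. f j * (if i = j then 1 else 0))"
    by (rule sum.cong) (use assms orthonormal_complete in \<open>simp_all flip: sum_distrib_left\<close>)
  also have "\<dots> = f i" using assms(2) by (simp add: if_distrib cong: if_cong)
  finally show ?thesis by simp
qed

text \<open>Carries orthonormality from coordinate vectors to the vectors themselves in the
  induction step of the spectral theorem.\<close>

lemma orthonormal_inner: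
  assumes "orthonormal n w"
  shows "(\<Sum>p<n. cnj (\<Sum>j<n. x j * w j p) * (\<Sum>j<n. y j * w j p)) = (\<Sum>j<n. cnj (x j) * y j)"
proof -
  have "(\<Sum>p<n. cnj (\<Sum>j<n. x j * w j p) * (\<Sum>j<n. y j * w j p))
      = (\<Sum>p<n. \<Sum>i<n. \<Sum>j<n. cnj (x i) * y j * (cnj (w i p) * w j p))"
    unfolding cnj_sum sum_product by (intro sum.cong refl) (simp add: mult_ac)
  also have "\<dots> = (\<Sum>i<n. \<Sum>j<n. \<Sum>p<n. cnj (x i) * y j * (cnj (w i p) * w j p))"
    by (subst sum.swap, rule sum.cong[OF refl], rule sum.swap)
  also have "\<dots> = (\<Sum>i<n. \<Sum>j<n. cnj (x i) * y j * (if i = j then 1 else 0))"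
    using assms by (intro sum.cong refl) (simp add: orthonormal_def flip: sum_distrib_left)
  also have "\<dots> = (\<Sum>j<n. cnj (x j) * y j)" by (simp add: if_distrib cong: if_cong)
  finally show ?thesis .
qed

text \<open>Induction on the dimension: in an orthonormal basis that starts with a unit eigenvector,
  Hermiticity clears the first row along with the first column, and the remaining block is Hermitian
  of size one less.\<close>

theorem hermitian_spectral:
  fixes A :: "nat \<Rightarrow> nat \<Rightarrow> complex"
  assumes "\<And>i j. i < n \<Longrightarrow> j < n \<Longrightarrow> A j i = cnj (A i j)"
  shows "\<exists>u l. orthonormal n u \<and>
    (\<forall>k<n. \<forall>i<n. (\<Sum>j<n. A i j * u k j) = complex_of_real (l k) * u k i)"
  using assms
proof (induction n arbitrary: A)
  case 0
  show ?case by (simp add: orthonormal_def)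
next
  case (Suc m)
  let ?n = "Suc m"
  obtain v e where v: "(\<Sum>i<?n. cnj (v i) * v i) = 1"
    and ev: "\<And>i. i < ?n \<Longrightarrow> (\<Sum>j<?n. A i j * v j) = e * v i"
    using exists_eigenvector[of ?n A] by blast
  have "e \<in> \<real>" using hermitian_eigenvalue_real[of ?n A v e] Suc.prems v ev by blast
  then obtain e' where e': "e = complex_of_real e'" by (auto elim: Reals_cases)
  obtain w where w: "orthonormal ?n w" and w0: "\<And>i. i < ?n \<Longrightarrow> w 0 i = v i"
    using orthonormal_extension[OF v] by blast
  have A_cnj: "cnj (A p q) = A q p" if "p < ?n" "q < ?n" for p q
    using Suc.prems[OF that] by (rule sym)
  \<comment> \<open>The matrix of \<open>A\<close> in the basis \<open>w\<close>.\<close>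
  define a where "a i j = (\<Sum>p<?n. cnj (w i p) * (\<Sum>q<?n. A p q * w j q))" for i j
  have a_herm: "a j i = cnj (a i j)" for i j
  proof -
    have "cnj (a i j) = (\<Sum>p<?n. \<Sum>q<?n. cnj (cnj (w i p) * (A p q * w j q)))"
      by (simp add: a_def sum_distrib_left cnj_sum del: sum.lessThan_Suc)
    also have "\<dots> = (\<Sum>p<?n. \<Sum>q<?n. cnj (w j q) * (A q p * w i p))"
      by (intro sum.cong refl) (simp add: A_cnj mult_ac)
    also have "\<dots> = a j i"
      unfolding a_def by (subst sum.swap) (simp add: sum_distrib_left del: sum.lessThan_Suc)
    finally show ?thesis by simp
  qed
  have a0: "a i 0 = (if i = 0 then e else 0)" if "i < ?n" for i
  proof -
    have "a i 0 = (\<Sum>p<?n. cnj (w i p) * (e * w 0 p))"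
      unfolding a_def using ev w0 by (intro sum.cong refl) (simp del: sum.lessThan_Suc)
    also have "\<dots> = e * (\<Sum>p<?n. cnj (w i p) * w 0 p)"
      by (simp add: sum_distrib_left mult.left_commute del: sum.lessThan_Suc)
    finally show ?thesis using w that by (simp add: orthonormal_def del: sum.lessThan_Suc)
  qed
  have a0': "a 0 i = (if i = 0 then e else 0)" if "i < ?n" for i
    using a_herm[of 0 i] a0[OF that] e' by simp
  have Aw: "(\<Sum>q<?n. A p q * w j q) = (\<Sum>i<?n. a i j * w i p)" if "p < ?n" for p j
    unfolding a_def using orthonormal_expansion[OF w that, of "\<lambda>p. \<Sum>q<?n. A p q * w j q"] .
  obtain y l where y: "orthonormal m y" and
    yev: "\<And>k i. k < m \<Longrightarrow> i < m \<Longrightarrow>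
      (\<Sum>j<m. a (Suc i) (Suc j) * y k j) = complex_of_real (l k) * y k i"
    using Suc.IH[of "\<lambda>i j. a (Suc i) (Suc j)"] a_herm by blast
  \<comment> \<open>Coordinates of the new eigenvectors in the basis \<open>w\<close>: number 0 is
    \<open>v\<close> itself, the others are the eigenvectors of the block with a zero put in
    front.\<close>
  define x where "x k j = (case (k, j) of (0, 0) \<Rightarrow> 1 | (Suc k, Suc j) \<Rightarrow> y k j | _ \<Rightarrow> 0)" for k j
  have x[simp]: "x 0 0 = 1" "x 0 (Suc j) = 0" "x (Suc k) 0 = 0" "x (Suc k) (Suc j) = y k j" for k j
    by (simp_all add: x_def)
  define u where "u k p = (\<Sum>j<?n. x k j * w j p)" for k p
  define l' where "l' k = (case k of 0 \<Rightarrow> e' | Suc k \<Rightarrow> l k)" for k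
  have xo: "(\<Sum>j<?n. cnj (x k j) * x k' j) = (if k = k' then 1 else 0)" if "k < ?n" "k' < ?n" for k k'
    using that y unfolding sum.lessThan_Suc_shift
    by (cases k; cases k') (auto simp: orthonormal_def)
  have xev: "(\<Sum>j<?n. a i j * x k j) = complex_of_real (l' k) * x k i" if "k < ?n" "i < ?n" for k i
    using that a0 a0' yev e' unfolding sum.lessThan_Suc_shift
    by (cases k; cases i) (auto simp: l'_def)
  have "orthonormal ?n u"
    unfolding orthonormal_def u_def using orthonormal_inner[OF w] xo by metis
  moreover have "(\<Sum>q<?n. A p q * u k q) = complex_of_real (l' k) * u k p" if "k < ?n" "p < ?n" for k p
  proof -
    have "(\<Sum>q<?n. A p q * u k q) = (\<Sum>j<?n. x k j * (\<Sum>q<?n. A p q * w j q))"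
      unfolding u_def sum_distrib_left by (subst sum.swap) (simp add: mult_ac del: sum.lessThan_Suc)
    also have "\<dots> = (\<Sum>j<?n. \<Sum>i<?n. x k j * (a i j * w i p))"
      using Aw[OF that(2)] by (simp add: sum_distrib_left del: sum.lessThan_Suc)
    also have "\<dots> = (\<Sum>i<?n. (\<Sum>j<?n. a i j * x k j) * w i p)"
      unfolding sum_distrib_right by (subst sum.swap) (simp add: mult_ac del: sum.lessThan_Suc)
    also have "\<dots> = (\<Sum>i<?n. complex_of_real (l' k) * x k i * w i p)"
      using xev[OF that(1)] by (intro sum.cong refl) (simp del: sum.lessThan_Suc)
    also have "\<dots> = complex_of_real (l' k) * u k p"
      by (simp add: u_def sum_distrib_left mult.assoc del: sum.lessThan_Suc)
    finally show ?thesis .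
  qed
  ultimately show ?case by blast
qed

text \<open>Insert the completeness relation to the right of \<open>A\<close> and let
  \<open>A\<close> act on each basis vector.\<close>

lemma spectral_entries:
  assumes "orthonormal n u"
    and "\<And>k i. k < n \<Longrightarrow> i < n \<Longrightarrow> (\<Sum>j<n. A i j * u k j) = complex_of_real (l k) * u k i"
    and "i < n" "j < n"
  shows "A i j = (\<Sum>k<n. complex_of_real (l k) * u k i * cnj (u k j))"
proof -
  have "A i j = (\<Sum>q<n. A i q * (if q = j then 1 else 0))" using assms(4) by (simp add: if_distrib cong: if_cong)
  also have "\<dots> = (\<Sum>q<n. A i q * (\<Sum>k<n. u k q * cnj (u k j)))"
    using orthonormal_complete[OF assms(1)] assms(4) by (intro sum.cong refl) simp
  also have "\<dots> = (\<Sum>k<n. (\<Sum>q<n. A i q * u k q) * cnj (u k j))"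
    unfolding sum_distrib_left sum_distrib_right by (subst sum.swap) (simp add: mult_ac)
  also have "\<dots> = (\<Sum>k<n. complex_of_real (l k) * u k i * cnj (u k j))"
    using assms(2,3) by simp
  finally show ?thesis .
qed

subsection \<open>Square roots and ground states\<close>

definition qform :: "nat \<Rightarrow> (nat \<Rightarrow> nat \<Rightarrow> complex) \<Rightarrow> (nat \<Rightarrow> complex) \<Rightarrow> complex" where
  "qform n A v = (\<Sum>i<n. \<Sum>j<n. cnj (v i) * A i j * v j)"

lemma qform_diff: "qform n (\<lambda>i j. A i j - B i j) v = qform n A v - qform n B v"
  by (simp add: qform_def algebra_simps sum_subtractf)

lemma qform_eigenvector:
  assumes "\<And>i. i < n \<Longrightarrow> (\<Sum>j<n. A i j * v j) = e * v i"
  shows "qform n A v = e * (\<Sum>i<n. cnj (v i) * v i)"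
proof -
  have "qform n A v = (\<Sum>i<n. cnj (v i) * (\<Sum>j<n. A i j * v j))"
    by (simp add: qform_def sum_distrib_left mult.assoc)
  also have "\<dots> = (\<Sum>i<n. cnj (v i) * (e * v i))" using assms by simp
  finally show ?thesis by (simp add: sum_distrib_left mult.left_commute)
qed

text \<open>All eigenvalues vanish, hence so does every term of the spectral decomposition. The
  premise \<open>ev\<close> concerns one unit eigenvector at a time, which reduces matrix identities
  to scalar ones.\<close>

lemma hermitian_eq_0:
  fixes A :: "nat \<Rightarrow> nat \<Rightarrow> complex"
  assumes herm: "\<And>i j. i < n \<Longrightarrow> j < n \<Longrightarrow> A j i = cnj (A i j)"
    and ev: "\<And>v e. (\<Sum>i<n. cnj (v i) * v i) = 1 \<Longrightarrow>
      (\<And>i. i < n \<Longrightarrow> (\<Sum>j<n. A i j * v j) = complex_of_real e * v i) \<Longrightarrow> e = 0"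
    and "i < n" "j < n"
  shows "A i j = 0"
proof -
  obtain u l where u: "orthonormal n u"
    and l: "\<And>k i. k < n \<Longrightarrow> i < n \<Longrightarrow> (\<Sum>j<n. A i j * u k j) = complex_of_real (l k) * u k i"
    using hermitian_spectral[of n A] herm by blast
  have "l k = 0" if "k < n" for k
    using ev[of "u k" "l k"] l[OF that] u that by (simp add: orthonormal_def)
  then show ?thesis using spectral_entries[OF u l assms(3,4)] by simp
qed

lemma pos_semidef_iff_qform:
  assumes P: "P \<in> carrier_mat n n"
  shows "pos_semidef P \<longleftrightarrow> (\<forall>v. 0 \<le> qform n (\<lambda>i j. P $$ (i, j)) v)"
proof -
  have q: "(P *\<^sub>v v) \<bullet>c v = qform n (\<lambda>i j. P $$ (i, j)) (\<lambda>i. v $ i)"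
    if "v \<in> carrier_vec n" for v
    using that P
    by (auto simp: qform_def scalar_prod_def atLeast0LessThan sum_distrib_left sum_distrib_right
        mult_ac intro!: sum.cong)
  have q': "qform n (\<lambda>i j. P $$ (i, j)) v = (P *\<^sub>v vec n v) \<bullet>c vec n v" for v
    unfolding q[OF vec_carrier] by (simp add: qform_def)
  have "pos_semidef P \<longleftrightarrow> (\<forall>v \<in> carrier_vec n. 0 \<le> (P *\<^sub>v v) \<bullet>c v)"
    using P by (simp add: pos_semidef_def)
  also have "\<dots> \<longleftrightarrow> (\<forall>v. 0 \<le> qform n (\<lambda>i j. P $$ (i, j)) v)"
    using q q' by (metis vec_carrier)
  finally show ?thesis .
qed

text \<open>The difference of \<open>p\<close> and its adjoint, multiplied by \<open>\<i>\<close>,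
  is Hermitian, and its form vanishes because the form of \<open>p\<close> is real. Hence it has no
  non-zero eigenvalue.\<close>

lemma pos_semidef_hermitian:
  assumes P: "P \<in> carrier_mat n n" "pos_semidef P" and ij: "i < n" "j < n"
  shows "P $$ (j, i) = cnj (P $$ (i, j))"
proof -
  define p where "p i j = P $$ (i, j)" for i j
  define M where "M i j = \<i> * (p i j - cnj (p j i))" for i j
  have "M i j = 0"
  proof (rule hermitian_eq_0[OF _ _ ij])
    fix v e assume v: "(\<Sum>i<n. cnj (v i) * v i) = 1"
      "\<And>i. i < n \<Longrightarrow> (\<Sum>j<n. M i j * v j) = complex_of_real e * v i"
    have "0 \<le> qform n p v" using P by (simp add: pos_semidef_iff_qform p_def[abs_def])
    then have "cnj (qform n p v) = qform n p v"
      by (simp add: less_eq_complex_def complex_eq_iff)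
    moreover have "qform n M v = \<i> * (qform n p v - cnj (qform n p v))"
    proof -
      have "cnj (qform n p v) = (\<Sum>i<n. \<Sum>j<n. v j * cnj (p j i) * cnj (v i))"
        unfolding qform_def cnj_sum by (subst sum.swap) simp
      then show ?thesis
        by (simp add: qform_def M_def sum_distrib_left algebra_simps sum_subtractf)
    qed
    ultimately have "qform n M v = 0" by simp
    then show "e = 0" using qform_eigenvector[OF v(2)] v(1) by simp
  qed (simp add: M_def algebra_simps)
  then show ?thesis by (simp add: M_def p_def)
qed

text \<open>With \<open>D = p - q\<close>, equality of the squares gives
  \<open>p D + D q = 0\<close>. At a unit eigenvector of \<open>D\<close> with eigenvalue
  \<open>e\<close> this says that \<open>e\<close> times the sum of the two forms is 0. Either
  \<open>e = 0\<close>, or both forms, being non-negative, vanish there, and then \<open>e\<close>,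
  which is their difference, vanishes too.\<close>

lemma psd_square_root_unique:
  fixes p q :: "nat \<Rightarrow> nat \<Rightarrow> complex"
  assumes hp: "\<And>i j. i < n \<Longrightarrow> j < n \<Longrightarrow> p j i = cnj (p i j)"
    and hq: "\<And>i j. i < n \<Longrightarrow> j < n \<Longrightarrow> q j i = cnj (q i j)"
    and psd: "\<And>v. 0 \<le> Re (qform n p v)" "\<And>v. 0 \<le> Re (qform n q v)"
    and sq: "\<And>i j. i < n \<Longrightarrow> j < n \<Longrightarrow> (\<Sum>m<n. p i m * p m j) = (\<Sum>m<n. q i m * q m j)"
    and ij: "i < n" "j < n"
  shows "p i j = q i j"
proof -
  define D where "D i j = p i j - q i j" for i j
  have cnjD: "cnj (D i j) = D j i" if "i < n" "j < n" for i j
    using hp[OF that] hq[OF that] by (simp add: D_def)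
  have "D i j = 0"
  proof (rule hermitian_eq_0[OF _ _ ij])
    fix v e assume v: "(\<Sum>i<n. cnj (v i) * v i) = 1"
      and ev: "\<And>i. i < n \<Longrightarrow> (\<Sum>j<n. D i j * v j) = complex_of_real e * v i"
    have ev': "(\<Sum>i<n. cnj (v i) * D i m) = complex_of_real e * cnj (v m)" if "m < n" for m
    proof -
      have "cnj (\<Sum>i<n. D m i * v i) = (\<Sum>i<n. cnj (v i) * D i m)"
        unfolding cnj_sum using that by (intro sum.cong refl) (simp add: cnjD)
      then show ?thesis using ev[OF that] by simp
    qed
    have 1: "qform n (\<lambda>i j. \<Sum>m<n. p i m * D m j) v = e * qform n p v"
    proof -
      have "qform n (\<lambda>i j. \<Sum>m<n. p i m * D m j) v
          = (\<Sum>i<n. \<Sum>m<n. cnj (v i) * p i m * (\<Sum>j<n. D m j * v j))"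
        unfolding qform_def sum_distrib_left sum_distrib_right
        by (rule sum.cong[OF refl], subst sum.swap) (simp add: mult_ac)
      also have "\<dots> = (\<Sum>i<n. \<Sum>m<n. cnj (v i) * p i m * (e * v m))" using ev by simp
      finally show ?thesis by (simp add: qform_def sum_distrib_left mult_ac)
    qed
    have 2: "qform n (\<lambda>i j. \<Sum>m<n. D i m * q m j) v = e * qform n q v"
    proof -
      have "qform n (\<lambda>i j. \<Sum>m<n. D i m * q m j) v
          = (\<Sum>i<n. \<Sum>m<n. \<Sum>j<n. cnj (v i) * D i m * (q m j * v j))"
        unfolding qform_def sum_distrib_left sum_distrib_right
        by (rule sum.cong[OF refl], subst sum.swap) (simp add: mult_ac)
      also have "\<dots> = (\<Sum>m<n. (\<Sum>i<n. cnj (v i) * D i m) * (\<Sum>j<n. q m j * v j))"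
        by (subst sum.swap) (simp add: sum_product)
      also have "\<dots> = (\<Sum>m<n. e * cnj (v m) * (\<Sum>j<n. q m j * v j))" using ev' by simp
      finally show ?thesis by (simp add: qform_def sum_distrib_left mult_ac)
    qed
    have "qform n (\<lambda>i j. \<Sum>m<n. p i m * D m j) v + qform n (\<lambda>i j. \<Sum>m<n. D i m * q m j) v
        = (\<Sum>i<n. \<Sum>j<n. cnj (v i) * ((\<Sum>m<n. p i m * p m j) - (\<Sum>m<n. q i m * q m j)) * v j)"
      unfolding qform_def sum.distrib[symmetric]
      by (intro sum.cong refl)
        (simp add: D_def algebra_simps sum_subtractf flip: sum.distrib)
    also have "\<dots> = 0" using sq by simp
    finally have "e * (qform n p v + qform n q v) = 0" unfolding 1 2 by (simp add: distrib_left)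
    then consider "e = 0" | "qform n p v + qform n q v = 0" by auto
    then show "e = 0"
    proof cases
      case 2
      then have "Re (qform n p v) + Re (qform n q v) = 0" by (metis plus_complex.sel(1) zero_complex.sel(1))
      then have "Re (qform n p v) = 0" "Re (qform n q v) = 0" using psd[of v] by linarith+
      moreover have "qform n p v - qform n q v = e"
        using qform_eigenvector[OF ev] v unfolding D_def qform_diff by simp
      ultimately show ?thesis by (metis Re_complex_of_real diff_zero minus_complex.sel(1))
    qed
  next
    fix i j assume "i < n" "j < n"
    then show "D j i = cnj (D i j)" by (simp add: cnjD)
  qed
  then show ?thesis by (simp add: D_def)
qed

section \<open>The modulus of a matrix\<close>

lemma mat_adjoint_entries:
  assumes "X \<in> carrier_mat n n" "i < n" "j < n"
  shows "mat_adjoint X $$ (i, j) = cnj (X $$ (j, i))"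
  using assms by (simp add: mat_adjoint_def mat_of_rows_def)

lemma mat_mult_entries:
  assumes "A \<in> carrier_mat n n" "B \<in> carrier_mat n n" "i < n" "j < n"
  shows "(A * B) $$ (i, j) = (\<Sum>m<n. A $$ (i, m) * B $$ (m, j))"
  using assms by (auto simp: scalar_prod_def atLeast0LessThan)

text \<open>Uniqueness of the positive square root resolves the definite description in
  \<open>mat_abs\<close>, so that exhibiting one square root suffices.\<close>

lemma mat_abs_eqI:
  assumes X: "X \<in> carrier_mat n n" and R: "R \<in> carrier_mat n n" "pos_semidef R"
    and sq: "R * R = mat_adjoint X * X"
  shows "mat_abs X = R"
  unfolding mat_abs_def
proof (rule the_equality)
  show "R \<in> carrier_mat (dim_col X) (dim_col X) \<and> pos_semidef R \<and> R * R = mat_adjoint X * X"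
    using assms by simp
next
  fix P assume "P \<in> carrier_mat (dim_col X) (dim_col X) \<and> pos_semidef P \<and>
    P * P = mat_adjoint X * X"
  then have P: "P \<in> carrier_mat n n" "pos_semidef P" "P * P = R * R" using X sq by auto
  have "P $$ (i, j) = R $$ (i, j)" if ij: "i < n" "j < n" for i j
  proof (rule psd_square_root_unique[where p = "\<lambda>i j. P $$ (i, j)" and q = "\<lambda>i j. R $$ (i, j)",
        OF _ _ _ _ _ ij])
    show "0 \<le> Re (qform n (\<lambda>i j. P $$ (i, j)) v)" "0 \<le> Re (qform n (\<lambda>i j. R $$ (i, j)) v)" for v
      using P R by (auto simp: pos_semidef_iff_qform less_eq_complex_def)
    fix i j assume ij: "i < n" "j < n"
    show "P $$ (j, i) = cnj (P $$ (i, j))" by (rule pos_semidef_hermitian[OF P(1,2) ij])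
    show "R $$ (j, i) = cnj (R $$ (i, j))" by (rule pos_semidef_hermitian[OF R ij])
    show "(\<Sum>m<n. P $$ (i, m) * P $$ (m, j)) = (\<Sum>m<n. R $$ (i, m) * R $$ (m, j))"
      unfolding mat_mult_entries[OF P(1) P(1) ij, symmetric]
        mat_mult_entries[OF R(1) R(1) ij, symmetric] P(3) ..
  qed
  then show "P = R" using P R by auto
qed

section \<open>The variational principle\<close>

lemma qform_spectral:
  assumes "\<And>i j. i < n \<Longrightarrow> j < n \<Longrightarrow>
      A i j = (\<Sum>k<m. complex_of_real (l k) * u k i * cnj (u k j))"
  shows "qform n A f = complex_of_real (\<Sum>k<m. l k * (cmod (\<Sum>j<n. cnj (u k j) * f j))\<^sup>2)"
proof -
  have "qform n A f = (\<Sum>i<n. \<Sum>j<n. \<Sum>k<m. l k * (cnj (f i) * u k i * (cnj (u k j) * f j)))"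
    unfolding qform_def
    by (intro sum.cong refl) (simp add: assms sum_distrib_left sum_distrib_right mult_ac)
  also have "\<dots> = (\<Sum>k<m. \<Sum>i<n. \<Sum>j<n. l k * (cnj (f i) * u k i * (cnj (u k j) * f j)))"
    by (subst sum.swap, subst sum.swap) (intro sum.cong refl sum.swap)
  also have "\<dots> = (\<Sum>k<m. l k * (cnj (\<Sum>j<n. cnj (u k j) * f j) * (\<Sum>j<n. cnj (u k j) * f j)))"
    by (simp only: cnj_sum sum_product) (simp add: sum_distrib_left mult_ac)
  also have "\<dots> = complex_of_real (\<Sum>k<m. l k * (cmod (\<Sum>j<n. cnj (u k j) * f j))\<^sup>2)"
    unfolding of_real_sum of_real_mult
    by (intro sum.cong refl arg_cong2[of _ _ _ _ "(*)"]) (metis complex_norm_square mult.commute)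
  finally show ?thesis .
qed

lemma parseval:
  assumes "orthonormal n u"
  shows "(\<Sum>k<n. (cmod (\<Sum>j<n. cnj (u k j) * f j))\<^sup>2) = (\<Sum>i<n. (cmod (f i))\<^sup>2)"
proof -
  have 1: "qform n (\<lambda>i j. if i = j then 1 else 0) f
      = complex_of_real (\<Sum>k<n. 1 * (cmod (\<Sum>j<n. cnj (u k j) * f j))\<^sup>2)"
    by (rule qform_spectral) (simp add: orthonormal_complete[OF assms])
  have 2: "qform n (\<lambda>i j. if i = j then 1 else 0) f = (\<Sum>i<n. cnj (f i) * f i)"
  proof -
    have "cnj (f i) * (if i = j then 1 else 0) * f j = (if i = j then cnj (f i) * f j else 0)" for i j
      by simp
    then show ?thesis by (simp add: qform_def)
  qed
  show ?thesis
    using trans[OF 1[symmetric] 2] unfolding sum_cnj_mult_self mult_1 of_real_eq_iff .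
qed

text \<open>In an eigenbasis the energy is the sum of the eigenvalues \<open>l k\<close>, all at
  least \<open>E\<close>, weighted by the squared moduli of the coefficients \<open>c k\<close>.
  Equality forces \<open>l k = E\<close> wherever \<open>c k\<close> is non-zero. The form
  homogeneous in \<open>f\<close> avoids normalising trial states.\<close>

lemma ground_state_variational:
  fixes E :: real and H :: "nat \<Rightarrow> nat \<Rightarrow> complex" and f :: "nat \<Rightarrow> complex"
  assumes herm: "\<And>i j. i < n \<Longrightarrow> j < n \<Longrightarrow> H j i = cnj (H i j)"
    and low: "\<And>v e. (\<Sum>i<n. cnj (v i) * v i) = 1 \<Longrightarrow>
      (\<And>i. i < n \<Longrightarrow> (\<Sum>j<n. H i j * v j) = complex_of_real e * v i) \<Longrightarrow> E \<le> e"
  shows "E * (\<Sum>i<n. (cmod (f i))\<^sup>2) \<le> Re (qform n H f)"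
    and "Re (qform n H f) = E * (\<Sum>i<n. (cmod (f i))\<^sup>2) \<Longrightarrow> i < n \<Longrightarrow>
      (\<Sum>j<n. H i j * f j) = E * f i"
proof -
  obtain u l where u: "orthonormal n u"
    and l: "\<And>k i. k < n \<Longrightarrow> i < n \<Longrightarrow> (\<Sum>j<n. H i j * u k j) = complex_of_real (l k) * u k i"
    using hermitian_spectral[of n H] herm by blast
  have ent: "H i j = (\<Sum>k<n. complex_of_real (l k) * u k i * cnj (u k j))" if "i < n" "j < n" for i j
    by (rule spectral_entries[OF u _ that]) (rule l)
  define c where "c k = (\<Sum>j<n. cnj (u k j) * f j)" for k
  have El: "E \<le> l k" if "k < n" for k
    using low[of "u k" "l k"] l[OF that] u that by (simp add: orthonormal_def)
  have q: "Re (qform n H f) = (\<Sum>k<n. l k * (cmod (c k))\<^sup>2)"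
    by (subst qform_spectral[OF ent]) (simp_all add: c_def)
  have nf: "(\<Sum>i<n. (cmod (f i))\<^sup>2) = (\<Sum>k<n. (cmod (c k))\<^sup>2)"
    using parseval[OF u] by (simp add: c_def)
  show "E * (\<Sum>i<n. (cmod (f i))\<^sup>2) \<le> Re (qform n H f)"
    unfolding q nf sum_distrib_left by (rule sum_mono) (simp add: El mult_right_mono)
  assume eq: "Re (qform n H f) = E * (\<Sum>i<n. (cmod (f i))\<^sup>2)" and i: "i < n"
  have "(\<Sum>k<n. (l k - E) * (cmod (c k))\<^sup>2) = 0"
    using eq unfolding q nf by (simp add: left_diff_distrib sum_subtractf sum_distrib_left)
  then have "\<forall>k<n. (l k - E) * (cmod (c k))\<^sup>2 = 0"
    by (subst (asm) sum_nonneg_eq_0_iff) (auto simp: El)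
  then have lc: "complex_of_real (l k) * c k = E * c k" if "k < n" for k using that by auto
  have "(\<Sum>j<n. H i j * f j) = (\<Sum>j<n. \<Sum>k<n. complex_of_real (l k) * u k i * (cnj (u k j) * f j))"
    using ent[OF i] by (simp add: sum_distrib_left sum_distrib_right mult_ac)
  also have "\<dots> = (\<Sum>k<n. (complex_of_real (l k) * c k) * u k i)"
    by (subst sum.swap) (simp add: c_def sum_distrib_left sum_distrib_right mult_ac)
  also have "\<dots> = E * (\<Sum>k<n. c k * u k i)"
    unfolding sum_distrib_left
    by (intro sum.cong refl) (simp only: lessThan_iff lc mult.assoc[symmetric])
  also have "(\<Sum>k<n. c k * u k i) = f i"
    unfolding c_def by (rule orthonormal_expansion[OF u i, symmetric])
  finally show "(\<Sum>j<n. H i j * f j) = E * f i" .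
qed

subsection \<open>Reflection positivity\<close>

text \<open>The matrix with eigenbasis \<open>u\<close> and eigenvalues \<open>l\<close>. Changing
  \<open>l\<close> with \<open>u\<close> fixed is functional calculus, which is how the modulus is
  taken.\<close>

definition spectral_sum ::
    "nat \<Rightarrow> (nat \<Rightarrow> real) \<Rightarrow> (nat \<Rightarrow> nat \<Rightarrow> complex) \<Rightarrow> nat \<Rightarrow> nat \<Rightarrow> complex" where
  "spectral_sum n l u a b = (\<Sum>k<n. complex_of_real (l k) * u k a * cnj (u k b))"

lemma cnj_spectral_sum: "cnj (spectral_sum n l u a b) = spectral_sum n l u b a"
  by (simp add: spectral_sum_def mult_ac)

lemma spectral_sum_mult:
  assumes "orthonormal n u"
  shows "(\<Sum>b<n. spectral_sum n l u a b * spectral_sum n m u b c)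
    = spectral_sum n (\<lambda>k. l k * m k) u a c"
proof -
  have "(\<Sum>b<n. spectral_sum n l u a b * spectral_sum n m u b c)
      = (\<Sum>b<n. \<Sum>k<n. \<Sum>k'<n. l k * m k' * u k a * cnj (u k' c) * (cnj (u k b) * u k' b))"
    unfolding spectral_sum_def sum_product by (intro sum.cong refl) (simp add: mult_ac)
  also have "\<dots> = (\<Sum>k<n. \<Sum>k'<n. \<Sum>b<n. l k * m k' * u k a * cnj (u k' c) * (cnj (u k b) * u k' b))"
    by (subst sum.swap, rule sum.cong[OF refl], rule sum.swap)
  also have "\<dots> = (\<Sum>k<n. \<Sum>k'<n. l k * m k' * u k a * cnj (u k' c) * (if k = k' then 1 else 0))"
    using assms by (intro sum.cong refl) (simp add: orthonormal_def flip: sum_distrib_left)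
  also have "\<dots> = spectral_sum n (\<lambda>k. l k * m k) u a c"
    by (simp add: spectral_sum_def if_distrib cong: if_cong)
  finally show ?thesis .
qed

lemma spectral_sum_trace:
  assumes "orthonormal n u"
  shows "(\<Sum>a<n. spectral_sum n l u a a) = complex_of_real (\<Sum>k<n. l k)"
proof -
  have "(\<Sum>a<n. spectral_sum n l u a a) = (\<Sum>k<n. l k * (\<Sum>a<n. cnj (u k a) * u k a))"
    unfolding spectral_sum_def sum_distrib_left by (subst sum.swap) (simp add: mult_ac)
  also have "\<dots> = complex_of_real (\<Sum>k<n. l k)"
    using assms by (simp add: orthonormal_def)
  finally show ?thesis .
qed

text \<open>The expectation value, in the state with amplitudes D, of the operator
  K \<otimes> 1 + 1 \<otimes> K - W with W diagonal.\<close>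

definition mirror_form ::
    "nat \<Rightarrow> (nat \<Rightarrow> nat \<Rightarrow> real) \<Rightarrow> (nat \<Rightarrow> nat \<Rightarrow> real) \<Rightarrow> (nat \<Rightarrow> nat \<Rightarrow> complex) \<Rightarrow> complex" where
  "mirror_form n K W D =
     (\<Sum>a<n. \<Sum>a'<n. K a a' * (\<Sum>b<n. cnj (D a b) * D a' b))
     + (\<Sum>b<n. \<Sum>b'<n. K b b' * (\<Sum>a<n. cnj (D a b) * D a b'))
     - (\<Sum>a<n. \<Sum>b<n. W a b * (cnj (D a b) * D a b))"

text \<open>The adjoint exchanges the two K-terms; the transposition that this brings is absorbed by
  the symmetry of the real matrices \<open>K\<close> and \<open>W\<close>.\<close>

lemma mirror_form_adjoint:
  assumes K: "\<And>a b. a < n \<Longrightarrow> b < n \<Longrightarrow> K a b = K b a"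
    and W: "\<And>a b. a < n \<Longrightarrow> b < n \<Longrightarrow> W a b = W b a"
  shows "mirror_form n K W (\<lambda>a b. cnj (D b a)) = mirror_form n K W D"
proof -
  have 1: "(\<Sum>a<n. \<Sum>a'<n. K a a' * (\<Sum>b<n. D b a * cnj (D b a')))
      = (\<Sum>b<n. \<Sum>b'<n. K b b' * (\<Sum>a<n. cnj (D a b) * D a b'))"
    by (subst sum.swap) (intro sum.cong refl; simp add: K mult.commute)
  have 2: "(\<Sum>b<n. \<Sum>b'<n. K b b' * (\<Sum>a<n. D b a * cnj (D b' a)))
      = (\<Sum>a<n. \<Sum>a'<n. K a a' * (\<Sum>b<n. cnj (D a b) * D a' b))"
    by (subst sum.swap) (intro sum.cong refl; simp add: K mult.commute)
  have 3: "(\<Sum>a<n. \<Sum>b<n. W a b * (D b a * cnj (D b a)))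
      = (\<Sum>a<n. \<Sum>b<n. W a b * (cnj (D a b) * D a b))"
    by (subst sum.swap) (intro sum.cong refl; simp add: W mult.commute)
  show ?thesis unfolding mirror_form_def complex_cnj_cnj 1 2 3 by simp
qed

lemma mirror_form_scale:
  "mirror_form n K W (\<lambda>a b. d * D a b) = complex_of_real ((cmod d)\<^sup>2) * mirror_form n K W D"
proof -
  have "cnj (d * x) * (d * y) = complex_of_real ((cmod d)\<^sup>2) * (cnj x * y)" for x y
    unfolding complex_norm_square by (simp add: mult_ac)
  then show ?thesis
    unfolding mirror_form_def by (simp only:) (simp add: algebra_simps sum_distrib_left)
qed

text \<open>In terms of the sums \<open>w i\<close> the left side pairs
  \<open>w i * cnj (w j)\<close> with its conjugate, which cancels imaginary parts. What remains is
  twice the form of \<open>S\<close> at the real parts of \<open>w\<close> plus twice its value at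
  the imaginary parts.\<close>

lemma pair_weight_nonneg:
  fixes S :: "'i \<Rightarrow> 'i \<Rightarrow> real" and z :: "'i \<Rightarrow> nat \<Rightarrow> real"
  assumes W: "\<And>a b. a < n \<Longrightarrow> b < n \<Longrightarrow>
      W a b = (\<Sum>i\<in>I. \<Sum>j\<in>I. S i j * (z i a * z j b + z j a * z i b))"
    and S: "\<And>x. 0 \<le> (\<Sum>i\<in>I. \<Sum>j\<in>I. S i j * (x i * x j))"
  shows "\<exists>M\<ge>0. (\<Sum>a<n. \<Sum>b<n. W a b * (f a * cnj (f b))) = complex_of_real M"
proof -
  define w where "w i = (\<Sum>a<n. z i a * f a)" for i
  define M where "M = 2 * ((\<Sum>i\<in>I. \<Sum>j\<in>I. S i j * (Re (w i) * Re (w j)))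
    + (\<Sum>i\<in>I. \<Sum>j\<in>I. S i j * (Im (w i) * Im (w j))))"
  have "(\<Sum>a<n. \<Sum>b<n. W a b * (f a * cnj (f b)))
      = (\<Sum>a<n. \<Sum>b<n. \<Sum>i\<in>I. \<Sum>j\<in>I. S i j *
          (z i a * f a * cnj (z j b * f b) + z j a * f a * cnj (z i b * f b)))"
    by (intro sum.cong refl)
      (simp add: W sum_distrib_left sum_distrib_right algebra_simps)
  also have "\<dots> = (\<Sum>i\<in>I. \<Sum>j\<in>I. \<Sum>a<n. \<Sum>b<n. S i j *
          (z i a * f a * cnj (z j b * f b) + z j a * f a * cnj (z i b * f b)))"
    by (simp only: sum.swap[of _ I "{..<n}"])
  also have "\<dots> = (\<Sum>i\<in>I. \<Sum>j\<in>I. S i j * (w i * cnj (w j) + w j * cnj (w i)))"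
    unfolding w_def cnj_sum sum_product
    by (simp add: sum_distrib_left distrib_left sum.distrib)
  also have "\<dots> = complex_of_real M"
  proof -
    have "w i * cnj (w j) + w j * cnj (w i)
        = complex_of_real (2 * (Re (w i) * Re (w j) + Im (w i) * Im (w j)))" for i j
      by (simp add: complex_eq_iff)
    then show ?thesis
      by (simp add: M_def sum_distrib_left algebra_simps sum.distrib)
  qed
  finally show ?thesis using S[of "\<lambda>i. Re (w i)"] S[of "\<lambda>i. Im (w i)"]
    by (intro exI[of _ M]) (simp add: M_def)
qed

text \<open>The K-terms depend on D only through the products of D and its adjoint, which are the same
  for l and its modulus; the interaction term is a quadratic form in l with non-negative
  coefficients.\<close>

lemma mirror_form_spectral_sum_abs_le:
  fixes S :: "'i \<Rightarrow> 'i \<Rightarrow> real" and z :: "'i \<Rightarrow> nat \<Rightarrow> real"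
  assumes W: "\<And>a b. a < n \<Longrightarrow> b < n \<Longrightarrow>
      W a b = (\<Sum>i\<in>I. \<Sum>j\<in>I. S i j * (z i a * z j b + z j a * z i b))"
    and S: "\<And>x. 0 \<le> (\<Sum>i\<in>I. \<Sum>j\<in>I. S i j * (x i * x j))"
    and u: "orthonormal n u"
  shows "Re (mirror_form n K W (spectral_sum n (\<lambda>k. \<bar>l k\<bar>) u))
    \<le> Re (mirror_form n K W (spectral_sum n l u))"
proof -
  \<comment> \<open>The squared modulus of entry \<open>(a, b)\<close> of a spectral sum expands
    into terms, one for each pair \<open>k\<close>, \<open>k'\<close>, that split into a function of
    \<open>a\<close> times the conjugate of the same function of \<open>b\<close>; this function is
    \<open>cnj (u k a) * u k' a\<close>.\<close>
  have "\<exists>M\<ge>0. (\<Sum>a<n. \<Sum>b<n. W a b * ((cnj (u k a) * u k' a) * cnj (cnj (u k b) * u k' b)))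
      = complex_of_real M" for k k'
    by (rule pair_weight_nonneg[OF W S, where f = "\<lambda>a. cnj (u k a) * u k' a"])
  then obtain M :: "nat \<Rightarrow> nat \<Rightarrow> real" where M0: "\<And>k k'. 0 \<le> M k k'"
    and M: "\<And>k k'. (\<Sum>a<n. \<Sum>b<n. W a b * ((cnj (u k a) * u k' a) * cnj (cnj (u k b) * u k' b)))
      = complex_of_real (M k k')" by metis
  have V: "(\<Sum>a<n. \<Sum>b<n. W a b * (cnj (spectral_sum n m u a b) * spectral_sum n m u a b))
      = complex_of_real (\<Sum>k<n. \<Sum>k'<n. m k * m k' * M k k')" for m
  proof -
    have "(\<Sum>a<n. \<Sum>b<n. W a b * (cnj (spectral_sum n m u a b) * spectral_sum n m u a b))
      = (\<Sum>a<n. \<Sum>b<n. \<Sum>k<n. \<Sum>k'<n. m k * m k' *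
          (W a b * ((cnj (u k a) * u k' a) * cnj (cnj (u k b) * u k' b))))"
      unfolding spectral_sum_def cnj_sum sum_product
      by (simp add: sum_distrib_left mult_ac)
    also have "\<dots> = (\<Sum>k<n. \<Sum>k'<n. \<Sum>a<n. \<Sum>b<n. m k * m k' *
          (W a b * ((cnj (u k a) * u k' a) * cnj (cnj (u k b) * u k' b))))"
    proof -
      \<comment> \<open>The four sums are treated as two sums over pairs, so that one exchange is
        enough.\<close>
      have sw: "(\<Sum>a<n. \<Sum>b<n. \<Sum>k<n. \<Sum>k'<n. g a b k k') = (\<Sum>k<n. \<Sum>k'<n. \<Sum>a<n. \<Sum>b<n. g a b k k')"
        for g :: "nat \<Rightarrow> nat \<Rightarrow> nat \<Rightarrow> nat \<Rightarrow> complex"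
        using sum.swap[of "\<lambda>p q. g (fst p) (snd p) (fst q) (snd q)" "{..<n} \<times> {..<n}" "{..<n} \<times> {..<n}"]
        by (simp add: sum.cartesian_product' flip: sum.cartesian_product)
      show ?thesis by (rule sw)
    qed
    also have "\<dots> = (\<Sum>k<n. \<Sum>k'<n. m k * m k' * complex_of_real (M k k'))"
      unfolding M[symmetric] by (simp only: sum_distrib_left)
    finally show ?thesis by simp
  qed
  have sq: "(\<lambda>k. \<bar>l k\<bar> * \<bar>l k\<bar>) = (\<lambda>k. l k * l k)" by auto
  have K1: "(\<Sum>b<n. cnj (spectral_sum n m u a b) * spectral_sum n m u a' b)
      = spectral_sum n (\<lambda>k. m k * m k) u a' a" for m a a'
    unfolding cnj_spectral_sum by (subst mult.commute) (rule spectral_sum_mult[OF u])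
  have K2: "(\<Sum>b<n. cnj (spectral_sum n m u b a) * spectral_sum n m u b a')
      = spectral_sum n (\<lambda>k. m k * m k) u a a'" for m a a'
    unfolding cnj_spectral_sum by (rule spectral_sum_mult[OF u])
  have "(\<Sum>k<n. \<Sum>k'<n. l k * l k' * M k k') \<le> (\<Sum>k<n. \<Sum>k'<n. \<bar>l k\<bar> * \<bar>l k'\<bar> * M k k')"
    by (intro sum_mono mult_right_mono M0) (metis abs_ge_self abs_mult)
  then show ?thesis unfolding mirror_form_def V K1 K2 sq by simp
qed

text \<open>The Frobenius norm sees only the squares of the eigenvalues, so passing to their moduli
  keeps a state normalised.\<close>

lemma spectral_sum_norm:
  assumes "orthonormal n u"
  shows "(\<Sum>a<n. \<Sum>b<n. (cmod (spectral_sum n l u a b))\<^sup>2) = (\<Sum>k<n. (l k)\<^sup>2)"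
proof -
  have "complex_of_real (\<Sum>a<n. \<Sum>b<n. (cmod (spectral_sum n l u a b))\<^sup>2)
      = (\<Sum>a<n. \<Sum>b<n. spectral_sum n l u a b * spectral_sum n l u b a)"
    unfolding of_real_sum complex_norm_square cnj_spectral_sum ..
  also have "\<dots> = complex_of_real (\<Sum>k<n. (l k)\<^sup>2)"
    by (simp only: spectral_sum_mult[OF assms] spectral_sum_trace[OF assms] power2_eq_square)
  finally show ?thesis by (simp only: of_real_eq_iff)
qed

lemma norm_eq_1_if_proportional:
  fixes C D :: "nat \<Rightarrow> nat \<Rightarrow> complex"
  assumes "\<And>a b. a < n \<Longrightarrow> b < n \<Longrightarrow> D a b = c * C a b"
    and "(\<Sum>a<n. \<Sum>b<n. (cmod (C a b))\<^sup>2) = 1" "(\<Sum>a<n. \<Sum>b<n. (cmod (D a b))\<^sup>2) = 1"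
  shows "cmod c = 1"
proof -
  have "(\<Sum>a<n. \<Sum>b<n. (cmod (D a b))\<^sup>2) = (cmod c)\<^sup>2 * (\<Sum>a<n. \<Sum>b<n. (cmod (C a b))\<^sup>2)"
    using assms(1) by (simp add: norm_mult power_mult_distrib sum_distrib_left)
  then have "(cmod c)\<^sup>2 = 1\<^sup>2" using assms(2,3) by simp
  then show ?thesis by (rule power2_eq_imp_eq) simp_all
qed

text \<open>Here \<open>lower\<close> is the variational principle, and \<open>ground\<close> is
  non-degeneracy in the form that any matrix attaining the bound is a multiple of \<open>C\<close>.
  The latter is applied to the adjoint of \<open>C\<close> and to the modulus \<open>P\<close>; both
  times the factor has modulus 1 because the norms agree.\<close>

theorem ground_state_positive_up_to_phase:
  fixes S :: "'i \<Rightarrow> 'i \<Rightarrow> real" and z :: "'i \<Rightarrow> nat \<Rightarrow> real" and C :: "nat \<Rightarrow> nat \<Rightarrow> complex"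
  assumes K: "\<And>a b. a < n \<Longrightarrow> b < n \<Longrightarrow> K a b = K b a"
    and W: "\<And>a b. a < n \<Longrightarrow> b < n \<Longrightarrow>
      W a b = (\<Sum>i\<in>I. \<Sum>j\<in>I. S i j * (z i a * z j b + z j a * z i b))"
    and S: "\<And>x. 0 \<le> (\<Sum>i\<in>I. \<Sum>j\<in>I. S i j * (x i * x j))"
    and lower: "\<And>D. E * (\<Sum>a<n. \<Sum>b<n. (cmod (D a b))\<^sup>2) \<le> Re (mirror_form n K W D)"
    and ground: "\<And>D. Re (mirror_form n K W D) = E * (\<Sum>a<n. \<Sum>b<n. (cmod (D a b))\<^sup>2) \<Longrightarrow>
      \<exists>c. \<forall>a<n. \<forall>b<n. D a b = c * C a b"
    and C: "Re (mirror_form n K W C) = E" "(\<Sum>a<n. \<Sum>b<n. (cmod (C a b))\<^sup>2) = 1"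
  obtains c p u where "cmod c = 1" "orthonormal n u" "\<And>k. 0 \<le> p k"
    "\<And>a b. a < n \<Longrightarrow> b < n \<Longrightarrow> C a b = c * spectral_sum n p u a b"
proof -
  have Wsym: "W a b = W b a" if "a < n" "b < n" for a b
    using that by (simp add: W algebra_simps)
  have adj1: "(\<Sum>a<n. \<Sum>b<n. (cmod (cnj (C b a)))\<^sup>2) = 1"
    using C(2) by (subst sum.swap) simp
  have "Re (mirror_form n K W (\<lambda>a b. cnj (C b a))) = E * (\<Sum>a<n. \<Sum>b<n. (cmod (cnj (C b a)))\<^sup>2)"
    using C(1) adj1 by (simp add: mirror_form_adjoint[OF K Wsym])
  from ground[OF this] obtain c where c: "\<And>a b. a < n \<Longrightarrow> b < n \<Longrightarrow> cnj (C b a) = c * C a b"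
    by blast
  have c1: "cmod c = 1" by (rule norm_eq_1_if_proportional[OF c C(2) adj1])
  \<comment> \<open>The phase is split evenly: since the adjoint of \<open>C\<close> is
    \<open>c\<close> times \<open>C\<close> and \<open>d * d = c\<close>, the multiple
    \<open>d * C\<close> is Hermitian.\<close>
  define d where "d = csqrt c"
  have d2: "d * d = c" by (simp add: d_def flip: power2_eq_square)
  have d1: "cmod d = 1"
  proof (rule power2_eq_imp_eq)
    show "(cmod d)\<^sup>2 = 1\<^sup>2" using c1 by (simp add: power2_eq_square flip: d2 norm_mult)
  qed simp_all
  have dd: "cnj d * d = 1" using d1 by (metis complex_norm_square mult.commute of_real_1 one_power2)
  define D where "D a b = d * C a b" for a b
  have D_herm: "D b a = cnj (D a b)" if "a < n" "b < n" for a b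
  proof -
    have "cnj (D a b) = cnj d * (d * d) * C b a" using c[OF that(2,1)] by (simp add: D_def d2)
    also have "\<dots> = (cnj d * d) * (d * C b a)" by (simp only: mult_ac)
    finally show ?thesis by (simp add: dd D_def)
  qed
  obtain u l where u: "orthonormal n u"
    and l: "\<And>k i. k < n \<Longrightarrow> i < n \<Longrightarrow> (\<Sum>j<n. D i j * u k j) = complex_of_real (l k) * u k i"
    using hermitian_spectral[of n D] D_herm by blast
  have Dl: "D a b = spectral_sum n l u a b" if "a < n" "b < n" for a b
    unfolding spectral_sum_def by (rule spectral_entries[OF u _ that]) (rule l)
  define P where "P = spectral_sum n (\<lambda>k. \<bar>l k\<bar>) u"
  \<comment> \<open>\<open>D\<close> and its spectral sum are known to agree only at indices below
    \<open>n\<close>, hence the rewriting under the sums.\<close>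
  have "mirror_form n K W D = mirror_form n K W (spectral_sum n l u)"
    unfolding mirror_form_def by (intro arg_cong2[of _ _ _ _ "(+)"] arg_cong2[of _ _ _ _ "(-)"]
      sum.cong refl arg_cong2[of _ _ _ _ "(*)"] arg_cong[of _ _ cnj]) (auto simp: Dl)
  then have DE: "Re (mirror_form n K W (spectral_sum n l u)) = E"
    using C(1) mirror_form_scale[of n K W d C] by (simp add: D_def[abs_def] d1)
  have D1: "(\<Sum>a<n. \<Sum>b<n. (cmod (spectral_sum n l u a b))\<^sup>2) = 1"
  proof -
    have "(\<Sum>a<n. \<Sum>b<n. (cmod (spectral_sum n l u a b))\<^sup>2) = (\<Sum>a<n. \<Sum>b<n. (cmod (D a b))\<^sup>2)"
      by (simp add: Dl)
    then show ?thesis using C(2) by (simp add: D_def norm_mult d1)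
  qed
  then have P1: "(\<Sum>a<n. \<Sum>b<n. (cmod (P a b))\<^sup>2) = 1"
    unfolding P_def spectral_sum_norm[OF u] by simp
  have "Re (mirror_form n K W P) \<le> Re (mirror_form n K W (spectral_sum n l u))"
    unfolding P_def by (rule mirror_form_spectral_sum_abs_le[OF _ S u]) (rule W)
  then have "Re (mirror_form n K W P) \<le> E" by (simp add: DE)
  then have "Re (mirror_form n K W P) = E * (\<Sum>a<n. \<Sum>b<n. (cmod (P a b))\<^sup>2)"
    using lower[of P] P1 by simp
  from ground[OF this] obtain e where e: "\<And>a b. a < n \<Longrightarrow> b < n \<Longrightarrow> P a b = e * C a b" by blast
  have e1: "cmod e = 1" by (rule norm_eq_1_if_proportional[OF e C(2) P1])
  show thesis
  proof (rule that[of "cnj e" u "\<lambda>k. \<bar>l k\<bar>"])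
    fix a b assume ab: "a < n" "b < n"
    \<comment> \<open>As \<open>e\<close> has modulus 1, its inverse is \<open>cnj e\<close>, which
      is the phase sought.\<close>
    have "cnj e * e = 1" using e1 by (metis complex_norm_square mult.commute of_real_1 one_power2)
    then show "C a b = cnj e * spectral_sum n (\<lambda>k. \<bar>l k\<bar>) u a b"
      using e[OF ab] by (simp add: P_def flip: mult.assoc)
  qed (use e1 u in auto)
qed

subsection \<open>Spin configurations and the Ising Hamiltonian\<close>

definition from_spins :: "nat \<Rightarrow> (nat \<Rightarrow> nat) \<Rightarrow> nat" where
  "from_spins N c = (\<Sum>i = 1..N. c i * 2 ^ (N - i))"

lemma from_spins_Suc: "from_spins (Suc N) c = 2 * from_spins N c + c (Suc N)"
proof -
  have "(\<Sum>i = 1..N. c i * 2 ^ (Suc N - i)) = 2 * (\<Sum>i = 1..N. c i * 2 ^ (N - i))"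
    unfolding sum_distrib_left by (rule sum.cong) (auto simp: Suc_diff_le)
  then show ?thesis by (simp add: from_spins_def)
qed

lemma spin_Suc: "i \<le> N \<Longrightarrow> spin (Suc N) i s = spin N i (s div 2)"
  by (simp add: spin_def Suc_diff_le div_mult2_eq)

lemma spin_last: "spin N N s = s mod 2"
  by (simp add: spin_def)

lemma spin_less_2: "spin N i s < 2"
  by (simp add: spin_def)

lemma from_spins_less: "(\<And>i. i \<in> {1..N} \<Longrightarrow> c i < 2) \<Longrightarrow> from_spins N c < 2 ^ N"
proof (induction N)
  case (Suc N)
  then have "from_spins N c < 2 ^ N" "c (Suc N) < 2" by auto
  then show ?case by (simp add: from_spins_Suc)
qed (simp add: from_spins_def)

lemma spin_from_spins:
  "(\<And>i. i \<in> {1..N} \<Longrightarrow> c i < 2) \<Longrightarrow> i \<in> {1..N} \<Longrightarrow> spin N i (from_spins N c) = c i"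
proof (induction N)
  case (Suc N)
  have c: "c (Suc N) < 2" using Suc.prems by auto
  show ?case
  proof (cases "i = Suc N")
    case True
    then show ?thesis using c by (simp add: spin_last from_spins_Suc)
  next
    case False
    then have "i \<in> {1..N}" using Suc.prems by auto
    then show ?thesis using Suc c by (simp add: spin_Suc from_spins_Suc)
  qed
qed simp

lemma from_spins_spin: "s < 2 ^ N \<Longrightarrow> from_spins N (\<lambda>i. spin N i s) = s"
proof (induction N arbitrary: s)
  case (Suc N)
  then have "s div 2 < 2 ^ N" by (simp add: less_mult_imp_div_less mult.commute)
  moreover have "from_spins N (\<lambda>i. spin (Suc N) i s) = from_spins N (\<lambda>i. spin N i (s div 2))"
    unfolding from_spins_def by (rule sum.cong) (auto simp: spin_Suc)
  ultimately show ?case using Suc.IH by (simp add: from_spins_Suc spin_last)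
qed (simp add: from_spins_def)

lemma from_spins_cong:
  "(\<And>i. i \<in> {1..N} \<Longrightarrow> c i = d i) \<Longrightarrow> from_spins N c = from_spins N d"
  unfolding from_spins_def by (rule sum.cong) auto

lemma eq_iff_spins_eq:
  assumes "s < 2 ^ N" "t < 2 ^ N"
  shows "s = t \<longleftrightarrow> (\<forall>i\<in>{1..N}. spin N i s = spin N i t)"
  using from_spins_cong[of N "\<lambda>i. spin N i s" "\<lambda>i. spin N i t"] from_spins_spin assms by metis

text \<open>The second half is read backwards, so that spin N + 1 - i of the joint index
  is spin i of b.\<close>

definition mirror_join :: "nat \<Rightarrow> nat \<Rightarrow> nat \<Rightarrow> nat" where
  "mirror_join m a b =
     from_spins (2 * m) (\<lambda>i. if i \<le> m then spin m i a else spin m (2 * m + 1 - i) b)"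

definition left_half :: "nat \<Rightarrow> nat \<Rightarrow> nat" where
  "left_half m s = from_spins m (\<lambda>i. spin (2 * m) i s)"

definition right_half :: "nat \<Rightarrow> nat \<Rightarrow> nat" where
  "right_half m s = from_spins m (\<lambda>i. spin (2 * m) (2 * m + 1 - i) s)"

lemma join_less: "mirror_join m a b < 2 ^ (2 * m)"
  unfolding mirror_join_def by (rule from_spins_less) (auto simp: spin_less_2)

lemma left_less: "left_half m s < 2 ^ m"
  unfolding left_half_def by (rule from_spins_less) (auto simp: spin_less_2)

lemma right_less: "right_half m s < 2 ^ m"
  unfolding right_half_def by (rule from_spins_less) (auto simp: spin_less_2)

lemma spin_join:
  assumes "i \<in> {1..m}"
  shows "spin (2 * m) i (mirror_join m a b) = spin m i a"
    and "spin (2 * m) (2 * m + 1 - i) (mirror_join m a b) = spin m i b"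
  using assms unfolding mirror_join_def by (subst spin_from_spins; auto simp: spin_less_2)+

lemma left_join: "a < 2 ^ m \<Longrightarrow> left_half m (mirror_join m a b) = a"
  unfolding left_half_def using from_spins_cong[of m _ "\<lambda>i. spin m i a"] spin_join(1) from_spins_spin
  by metis

lemma right_join: "b < 2 ^ m \<Longrightarrow> right_half m (mirror_join m a b) = b"
  unfolding right_half_def using from_spins_cong[of m _ "\<lambda>i. spin m i b"] spin_join(2) from_spins_spin
  by metis

text \<open>The reflection pairs each site of the first half with its mirror site; quantifiers, sums
  and products over all sites are split along it.\<close>

lemma atLeastAtMost_double:
  fixes m :: nat
  shows   "{1..2 * m} = {1..m} \<union> (\<lambda>i. 2 * m + 1 - i) ` {1..m}" "{1..m} \<inter> (\<lambda>i. 2 * m + 1 - i) ` {1..m} = {}"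
  "inj_on (\<lambda>i. 2 * m + 1 - i) {1..m}"
proof -
  show "{1..2 * m} = {1..m} \<union> (\<lambda>i. 2 * m + 1 - i) ` {1..m}" (is "?L = ?R")
  proof
    show "?L \<subseteq> ?R"
    proof
      fix i assume "i \<in> ?L"
      then show "i \<in> ?R"
        by (cases "i \<le> m") (auto intro!: image_eqI[of _ _ "2 * m + 1 - i"])
    qed
  qed auto
qed (auto simp: inj_on_def)

lemma ball_double:
  fixes m :: nat
  shows   "(\<forall>i\<in>{1..2 * m}. P i) \<longleftrightarrow> (\<forall>i\<in>{1..m}. P i) \<and> (\<forall>i\<in>{1..m}. P (2 * m + 1 - i))"
  unfolding atLeastAtMost_double(1) by blast

lemma sum_double:
  fixes m :: nat
  shows   "(\<Sum>i = 1..2 * m. f i) = (\<Sum>i = 1..m. f i) + (\<Sum>i = 1..m. f (2 * m + 1 - i))"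
  unfolding atLeastAtMost_double(1)
  by (subst sum.union_disjoint) (use atLeastAtMost_double(2,3) in \<open>auto simp: sum.reindex\<close>)

lemma prod_double:
  fixes m :: nat
  shows   "(\<Prod>i = 1..2 * m. f i) = (\<Prod>i = 1..m. f i) * (\<Prod>i = 1..m. f (2 * m + 1 - i))"
  unfolding atLeastAtMost_double(1)
  by (subst prod.union_disjoint) (use atLeastAtMost_double(2,3) in \<open>auto simp: prod.reindex\<close>)

lemma join_left_right: "s < 2 ^ (2 * m) \<Longrightarrow> mirror_join m (left_half m s) (right_half m s) = s"
proof -
  assume s: "s < 2 ^ (2 * m)"
  have "spin m i (left_half m s) = spin (2 * m) i s"
    "spin m i (right_half m s) = spin (2 * m) (2 * m + 1 - i) s" if "i \<in> {1..m}" for i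
    unfolding left_half_def right_half_def using that by (auto simp: spin_from_spins spin_less_2)
  then show ?thesis
    using s unfolding eq_iff_spins_eq[OF join_less s] ball_double by (simp add: spin_join del: One_nat_def)
qed

lemma join_eq_iff:
  assumes "a < 2 ^ m" "b < 2 ^ m" "a' < 2 ^ m" "b' < 2 ^ m"
  shows "mirror_join m a b = mirror_join m a' b' \<longleftrightarrow> a = a' \<and> b = b'"
  using assms left_join right_join by metis

lemma sum_join: "(\<Sum>s<2 ^ (2 * m). f s) = (\<Sum>a<2 ^ m. \<Sum>b<2 ^ m. f (mirror_join m a b))"
proof -
  have "(\<Sum>s<2 ^ (2 * m). f s) = (\<Sum>(a, b)\<in>{..<2 ^ m} \<times> {..<2 ^ m}. f (mirror_join m a b))"
    by (rule sum.reindex_bij_witness[where i = "\<lambda>(a, b). mirror_join m a b" and j = "\<lambda>s. (left_half m s, right_half m s)"])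
      (auto simp: join_left_right left_join right_join join_less left_less right_less)
  then show ?thesis by (simp add: sum.cartesian_product)
qed

text \<open>The operators of the second factor appear in reversed order because \<open>b\<close> is
  read backwards.\<close>

lemma tensor_op_join:
  assumes "a < 2 ^ m" "b < 2 ^ m" "a' < 2 ^ m" "b' < 2 ^ m"
  shows "tensor_op (2 * m) M $$ (mirror_join m a b, mirror_join m a' b')
    = tensor_op m M $$ (a, a') * tensor_op m (\<lambda>i. M (2 * m + 1 - i)) $$ (b, b')"
  unfolding tensor_op_def using assms
  by (simp only: index_mat(1) join_less prod_double split_conv) (simp add: spin_join del: One_nat_def)

lemma tensor_op_one:
  assumes "a < 2 ^ m" "b < 2 ^ m" and "\<And>i. i \<in> {1..m} \<Longrightarrow> M i = 1\<^sub>m 2"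
  shows "tensor_op m M $$ (a, b) = (if a = b then 1 else 0)"
proof -
  have "tensor_op m M $$ (a, b) = (\<Prod>i = 1..m. if spin m i a = spin m i b then 1 else 0)"
    using assms by (simp add: tensor_op_def spin_less_2)
  then show ?thesis unfolding eq_iff_spins_eq[OF assms(1,2)] by auto
qed

text \<open>The action of sigma_x at every site of a half on basis configurations.\<close>

definition complement :: "nat \<Rightarrow> nat \<Rightarrow> nat" where
  "complement m a = from_spins m (\<lambda>i. 1 - spin m i a)"

lemma complement_less: "complement m a < 2 ^ m"
  unfolding complement_def by (rule from_spins_less) auto

lemma spin_complement: "i \<in> {1..m} \<Longrightarrow> spin m i (complement m a) = 1 - spin m i a"
  unfolding complement_def by (subst spin_from_spins) auto

lemma complement_complement: "a < 2 ^ m \<Longrightarrow> complement m (complement m a) = a"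
proof -
  assume a: "a < 2 ^ m"
  have "1 - (1 - spin m i a) = spin m i a" for i using spin_less_2[of m i a] by linarith
  then show ?thesis
    unfolding eq_iff_spins_eq[OF complement_less a] by (simp add: spin_complement)
qed

lemma pauli_x_entry: "p < 2 \<Longrightarrow> q < 2 \<Longrightarrow> pauli_x $$ (p, q) = (if p = q then 0 else 1)"
  by (auto simp: pauli_x_def mat_of_rows_list_def less_2_cases_iff)

lemma pauli_z_entry:
  "p < 2 \<Longrightarrow> q < 2 \<Longrightarrow> pauli_z $$ (p, q) = (if p = q then 1 - 2 * of_nat p else 0)"
  by (auto simp: pauli_z_def mat_of_rows_list_def less_2_cases_iff)

lemma tensor_op_pauli_x:
  assumes "a < 2 ^ m" "b < 2 ^ m" and "\<And>i. i \<in> {1..m} \<Longrightarrow> M i = pauli_x"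
  shows "tensor_op m M $$ (a, b) = (if b = complement m a then 1 else 0)"
proof -
  have "(if spin m i a = spin m i b then 0 else 1) =
      (if spin m i b = 1 - spin m i a then 1 else 0 :: complex)" for i
    using spin_less_2[of m i a] spin_less_2[of m i b] by (auto simp: less_2_cases_iff)
  then have "tensor_op m M $$ (a, b) = (\<Prod>i = 1..m. if spin m i b = 1 - spin m i a then 1 else 0)"
    using assms by (simp add: tensor_op_def spin_less_2 pauli_x_entry)
  then show ?thesis
    unfolding eq_iff_spins_eq[OF assms(2) complement_less] by (auto simp: spin_complement)
qed

lemma splice_index_join:
  "splice_index (2 * m) {1..m} (mirror_join m a b) (mirror_join m a' b') = mirror_join m a b'"
proof -
  let ?c = "\<lambda>i. if i \<in> {1..m} then spin (2 * m) i (mirror_join m a b) else spin (2 * m) i (mirror_join m a' b')"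
  have "splice_index (2 * m) {1..m} (mirror_join m a b) (mirror_join m a' b') = from_spins (2 * m) ?c"
    by (simp add: splice_index_def from_spins_def)
  also have "\<dots> = from_spins (2 * m) (\<lambda>i. if i \<le> m then spin m i a else spin m (2 * m + 1 - i) b')"
  proof (rule from_spins_cong)
    fix i assume i: "i \<in> {1..2 * m}"
    show "?c i = (if i \<le> m then spin m i a else spin m (2 * m + 1 - i) b')"
    proof (cases "i \<le> m")
      case False
      then have "2 * m + 1 - i \<in> {1..m}" "2 * m + 1 - (2 * m + 1 - i) = i" using i by auto
      then show ?thesis using False spin_join(2)[of "2 * m + 1 - i" m a' b'] by simp
    qed (use i spin_join(1)[of i m] in simp)
  qed
  finally show ?thesis by (simp add: mirror_join_def)
qed

section \<open>Matrix elements of the Ising Hamiltonian\<close>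

definition zsign :: "nat \<Rightarrow> nat \<Rightarrow> nat \<Rightarrow> real" where
  "zsign N i s = 1 - 2 * real (spin N i s)"

text \<open>The matrix element of sigma_x at site \<open>i\<close>, as a real number.\<close>

definition flip_entry :: "nat \<Rightarrow> nat \<Rightarrow> nat \<Rightarrow> nat \<Rightarrow> real" where
  "flip_entry N i s t = (if \<forall>k\<in>{1..N}. spin N k s = spin N k t \<longleftrightarrow> k \<noteq> i then 1 else 0)"

text \<open>Used also with \<open>m\<close> in place of \<open>N\<close> and the same
  \<open>J\<close>: it then sees only the couplings inside the first half and serves as the matrix K
  of the overview.\<close>

definition ising_entry :: "nat \<Rightarrow> (nat \<Rightarrow> nat \<Rightarrow> real) \<Rightarrow> real \<Rightarrow> nat \<Rightarrow> nat \<Rightarrow> real" where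
  "ising_entry N J B s t =
     (if s = t then \<Sum>i = 1..N. \<Sum>j = 1..N. J i j * (zsign N i s * zsign N j s) else 0)
     + B * (\<Sum>i = 1..N. flip_entry N i s t)"

lemma site_op_pauli_z:
  assumes "s < 2 ^ N" "t < 2 ^ N" "i \<in> {1..N}"
  shows "site_op N pauli_z i $$ (s, t) = (if s = t then complex_of_real (zsign N i s) else 0)"
proof -
  have e: "(if k = i then pauli_z else 1\<^sub>m 2) $$ (spin N k s, spin N k t)
      = (if spin N k s = spin N k t then if k = i then complex_of_real (zsign N i s) else 1 else 0)" for k
    by (auto simp: pauli_z_entry spin_less_2 zsign_def)
  have "site_op N pauli_z i $$ (s, t)
      = (\<Prod>k = 1..N. if spin N k s = spin N k t then if k = i then complex_of_real (zsign N i s) else 1 else 0)"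
    using assms(1,2) by (simp add: site_op_def tensor_op_def e)
  also have "\<dots> = (if s = t then complex_of_real (zsign N i s) else 0)"
  proof (cases "s = t")
    case True
    then show ?thesis using assms(3) by simp
  next
    case False
    then obtain k where "k \<in> {1..N}" "spin N k s \<noteq> spin N k t"
      using eq_iff_spins_eq[OF assms(1,2)] by blast
    then show ?thesis using False by (auto intro!: prod_zero)
  qed
  finally show ?thesis .
qed

lemma site_op_pauli_x:
  assumes "s < 2 ^ N" "t < 2 ^ N"
  shows "site_op N pauli_x i $$ (s, t) = complex_of_real (flip_entry N i s t)"
proof -
  have e: "(if k = i then pauli_x else 1\<^sub>m 2) $$ (spin N k s, spin N k t)
      = (if spin N k s = spin N k t \<longleftrightarrow> k \<noteq> i then 1 else 0)" for k
    by (auto simp: pauli_x_entry spin_less_2)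
  have "site_op N pauli_x i $$ (s, t)
      = (\<Prod>k = 1..N. if spin N k s = spin N k t \<longleftrightarrow> k \<noteq> i then 1 else 0)"
    using assms by (simp add: site_op_def tensor_op_def e)
  also have "\<dots> = complex_of_real (flip_entry N i s t)"
    by (auto simp: flip_entry_def intro!: prod_zero)
  finally show ?thesis .
qed

lemma site_op_carrier: "site_op N M i \<in> carrier_mat (2 ^ N) (2 ^ N)"
  by (simp add: site_op_def tensor_op_def)

lemma ising_hamiltonian_carrier: "ising_hamiltonian N J B \<in> carrier_mat (2 ^ N) (2 ^ N)"
  by (simp add: ising_hamiltonian_def mat_sum_def)

lemma ising_hamiltonian_entry:
  assumes "s < 2 ^ N" "t < 2 ^ N"
  shows "ising_hamiltonian N J B $$ (s, t) = complex_of_real (ising_entry N J B s t)"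
proof -
  have zz: "(site_op N pauli_z i * site_op N pauli_z j) $$ (s, t)
      = (if s = t then complex_of_real (zsign N i s * zsign N j s) else 0)"
    if "i \<in> {1..N}" "j \<in> {1..N}" for i j
  proof -
    have "(site_op N pauli_z i * site_op N pauli_z j) $$ (s, t)
        = (\<Sum>r<2 ^ N. if r = s then if s = t then complex_of_real (zsign N i s * zsign N j s) else 0 else 0)"
      unfolding mat_mult_entries[OF site_op_carrier site_op_carrier assms]
      using that assms by (intro sum.cong refl) (auto simp: site_op_pauli_z)
    then show ?thesis using assms by simp
  qed
  have "ising_hamiltonian N J B $$ (s, t)
      = (\<Sum>(i, j)\<in>{1..N} \<times> {1..N}. complex_of_real (J i j) * (site_op N pauli_z i * site_op N pauli_z j) $$ (s, t))
        + B * (\<Sum>i = 1..N. complex_of_real (flip_entry N i s t))"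
    using assms
    by (simp add: ising_hamiltonian_def mat_sum_def site_op_pauli_x split_def
        carrier_matD[OF site_op_carrier])
  also have "(\<Sum>(i, j)\<in>{1..N} \<times> {1..N}. complex_of_real (J i j) * (site_op N pauli_z i * site_op N pauli_z j) $$ (s, t))
      = complex_of_real (if s = t then \<Sum>i = 1..N. \<Sum>j = 1..N. J i j * (zsign N i s * zsign N j s) else 0)"
    unfolding sum.cartesian_product[symmetric] by (auto simp: zz intro!: sum.cong)
  finally show ?thesis by (simp add: ising_entry_def)
qed

lemma ising_entry_sym: "ising_entry N J B s t = ising_entry N J B t s"
proof -
  have "flip_entry N i s t = flip_entry N i t s" for i
    unfolding flip_entry_def by (intro if_cong ball_cong refl) auto
  then show ?thesis by (simp add: ising_entry_def)
qed

lemma zsign_complement: "i \<in> {1..m} \<Longrightarrow> zsign m i (complement m a) = - zsign m i a"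
  using spin_less_2[of m i a] by (auto simp: zsign_def spin_complement less_2_cases_iff)

text \<open>Each coupling term carries two signs, whose changes cancel, and flipping all spins
  preserves at which sites two configurations differ.\<close>

lemma ising_entry_complement:
  assumes "a < 2 ^ m" "b < 2 ^ m"
  shows "ising_entry m J B (complement m a) (complement m b) = ising_entry m J B a b"
proof -
  have "complement m a = complement m b \<longleftrightarrow> a = b"
    using assms complement_complement by metis
  moreover have "flip_entry m i (complement m a) (complement m b) = flip_entry m i a b" for i
  proof -
    have "spin m k (complement m a) = spin m k (complement m b) \<longleftrightarrow> spin m k a = spin m k b"
      if "k \<in> {1..m}" for k
      using that spin_less_2[of m k a] spin_less_2[of m k b]
      by (auto simp: spin_complement less_2_cases_iff)
    then show ?thesis by (simp add: flip_entry_def)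
  qed
  ultimately show ?thesis by (simp add: ising_entry_def zsign_complement)
qed

lemma flip_entry_join:
  assumes "a < 2 ^ m" "b < 2 ^ m" "a' < 2 ^ m" "b' < 2 ^ m" and i: "i \<in> {1..m}"
  shows "flip_entry (2 * m) i (mirror_join m a b) (mirror_join m a' b') = (if b = b' then flip_entry m i a a' else 0)"
    and "flip_entry (2 * m) (2 * m + 1 - i) (mirror_join m a b) (mirror_join m a' b')
      = (if a = a' then flip_entry m i b b' else 0)"
proof -
  have n: "2 * m + 1 - k \<noteq> i" "k \<noteq> 2 * m + 1 - i" "2 * m + 1 - k = 2 * m + 1 - i \<longleftrightarrow> k = i"
    if "k \<in> {1..m}" for k using that i by auto
  have 1: "(\<forall>k\<in>{1..m}. spin (2 * m) k (mirror_join m a b) = spin (2 * m) k (mirror_join m a' b') \<longleftrightarrow> k \<noteq> i)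
      \<longleftrightarrow> (\<forall>k\<in>{1..m}. spin m k a = spin m k a' \<longleftrightarrow> k \<noteq> i)"
    "(\<forall>k\<in>{1..m}. spin (2 * m) k (mirror_join m a b) = spin (2 * m) k (mirror_join m a' b') \<longleftrightarrow> k \<noteq> 2 * m + 1 - i)
      \<longleftrightarrow> (\<forall>k\<in>{1..m}. spin m k a = spin m k a')"
    by (rule ball_cong[OF refl]; simp only: spin_join n simp_thms)+
  have 2: "(\<forall>k\<in>{1..m}. spin (2 * m) (2 * m + 1 - k) (mirror_join m a b)
        = spin (2 * m) (2 * m + 1 - k) (mirror_join m a' b') \<longleftrightarrow> 2 * m + 1 - k \<noteq> i)
      \<longleftrightarrow> (\<forall>k\<in>{1..m}. spin m k b = spin m k b')"
    "(\<forall>k\<in>{1..m}. spin (2 * m) (2 * m + 1 - k) (mirror_join m a b)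
        = spin (2 * m) (2 * m + 1 - k) (mirror_join m a' b') \<longleftrightarrow> 2 * m + 1 - k \<noteq> 2 * m + 1 - i)
      \<longleftrightarrow> (\<forall>k\<in>{1..m}. spin m k b = spin m k b' \<longleftrightarrow> k \<noteq> i)"
    by (rule ball_cong[OF refl]; simp only: spin_join n simp_thms)+
  show "flip_entry (2 * m) i (mirror_join m a b) (mirror_join m a' b') = (if b = b' then flip_entry m i a a' else 0)"
    unfolding flip_entry_def ball_double 1 2 eq_iff_spins_eq[OF assms(2,4)] by simp
  show "flip_entry (2 * m) (2 * m + 1 - i) (mirror_join m a b) (mirror_join m a' b')
      = (if a = a' then flip_entry m i b b' else 0)"
    unfolding flip_entry_def ball_double 1 2 eq_iff_spins_eq[OF assms(1,3)] by simp
qed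

text \<open>The mirror relation identifies the couplings inside the second half with those inside
  the first, so both halves have the same matrix. The couplings between the halves occur in both
  orders of the two sites, and the relation lets both be written with the entries of the cross
  coupling.\<close>

lemma ising_entry_join:
  assumes J: "\<forall>i \<in> {1..2 * m}. \<forall>j \<in> {1..2 * m}. J i j = J (2 * m + 1 - i) (2 * m + 1 - j)"
    and ab: "a < 2 ^ m" "b < 2 ^ m" "a' < 2 ^ m" "b' < 2 ^ m"
  shows "ising_entry (2 * m) J B (mirror_join m a b) (mirror_join m a' b')
    = (if b = b' then ising_entry m J B a a' else 0)
      + (if a = a' then ising_entry m J B b b' else 0)
      + (if a = a' \<and> b = b' then \<Sum>i = 1..m. \<Sum>j = 1..m. J i (2 * m + 1 - j) *
           (zsign m i a * zsign m j b + zsign m j a * zsign m i b) else 0)"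
proof -
  have z: "zsign (2 * m) i (mirror_join m a b) = zsign m i a"
    "zsign (2 * m) (2 * m + 1 - i) (mirror_join m a b) = zsign m i b" if "i \<in> {1..m}" for i
    using that by (simp_all add: zsign_def spin_join del: One_nat_def)
  have J1: "J (2 * m + 1 - i) (2 * m + 1 - j) = J i j" if "i \<in> {1..m}" "j \<in> {1..m}" for i j
    using J that by auto
  \<comment> \<open>The mirror relation at the sites \<open>2 * m + 1 - i\<close> and
    \<open>j\<close>. Merging the two orders of cross coupling in this way produces the symmetrised
    product of signs.\<close>
  have J2: "J (2 * m + 1 - i) j = J i (2 * m + 1 - j)" if "i \<in> {1..m}" "j \<in> {1..m}" for i j
  proof -
    have "2 * m + 1 - i \<in> {1..2 * m}" "j \<in> {1..2 * m}" "2 * m + 1 - (2 * m + 1 - i) = i"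
      using that by auto
    then show ?thesis using J by metis
  qed
  have zz: "(\<Sum>i = 1..2 * m. \<Sum>j = 1..2 * m. J i j *
        (zsign (2 * m) i (mirror_join m a b) * zsign (2 * m) j (mirror_join m a b)))
      = (\<Sum>i = 1..m. \<Sum>j = 1..m. J i j * (zsign m i a * zsign m j a))
        + (\<Sum>i = 1..m. \<Sum>j = 1..m. J i j * (zsign m i b * zsign m j b))
        + (\<Sum>i = 1..m. \<Sum>j = 1..m. J i (2 * m + 1 - j) *
           (zsign m i a * zsign m j b + zsign m j a * zsign m i b))"
    unfolding sum_double
    by (simp add: z J1 J2 sum.distrib distrib_left
        mult.commute[of "zsign m i b" "zsign m j a" for i j] del: One_nat_def)
  have f: "(\<Sum>i = 1..2 * m. flip_entry (2 * m) i (mirror_join m a b) (mirror_join m a' b'))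
      = (if b = b' then \<Sum>i = 1..m. flip_entry m i a a' else 0)
        + (if a = a' then \<Sum>i = 1..m. flip_entry m i b b' else 0)"
    unfolding sum_double using ab by (simp add: flip_entry_join del: One_nat_def)
  show ?thesis
    unfolding ising_entry_def join_eq_iff[OF ab] zz f by (simp add: distrib_left)
qed

subsection \<open>Negativity of the ground state\<close>

lemma mat_trace_overlap:
  assumes "\<phi> \<in> carrier_vec n" "\<psi> \<in> carrier_vec n"
  shows "Re (mat_trace (ket_bra \<phi> \<phi> * ket_bra \<psi> \<psi>)) = (cmod (\<Sum>s<n. cnj (\<phi> $ s) * \<psi> $ s))\<^sup>2"
proof -
  let ?x = "\<Sum>s<n. cnj (\<phi> $ s) * \<psi> $ s"
  have k: "ket_bra \<phi> \<phi> \<in> carrier_mat n n" "ket_bra \<psi> \<psi> \<in> carrier_mat n n"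
    using assms by (auto simp: ket_bra_def)
  have "mat_trace (ket_bra \<phi> \<phi> * ket_bra \<psi> \<psi>)
      = (\<Sum>s<n. \<Sum>t<n. (\<phi> $ s * cnj (\<phi> $ t)) * (\<psi> $ t * cnj (\<psi> $ s)))"
    using k mat_mult_entries[OF k] assms by (simp add: mat_trace_def ket_bra_def)
  also have "\<dots> = cnj ?x * ?x"
    unfolding cnj_sum sum_product by (intro sum.cong refl) (simp add: mult_ac)
  also have "\<dots> = complex_of_real ((cmod ?x)\<^sup>2)"
    unfolding complex_norm_square by (simp add: mult.commute)
  finally show ?thesis by simp
qed

text \<open>Used with the identity for Phi and with the flip of all spins for Phi'.\<close>

locale half_involution =
  fixes m :: nat and u :: "nat \<Rightarrow> nat"
  assumes u_less: "a < 2 ^ m \<Longrightarrow> u a < 2 ^ m"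
    and u_u: "a < 2 ^ m \<Longrightarrow> u (u a) = a"
begin

text \<open>Row \<open>a\<close> stands for the configuration \<open>u a\<close> of the first half,
  so \<open>\<psi> $ tjoin a b\<close> is the amplitude matrix after \<open>u\<close> has acted on
  that half.\<close>

definition tjoin :: "nat \<Rightarrow> nat \<Rightarrow> nat" where
  "tjoin a b = mirror_join m (u a) b"

lemma tjoin_less: "tjoin a b < 2 ^ (2 * m)"
  by (simp add: tjoin_def join_less)

lemma left_half_tjoin: "a < 2 ^ m \<Longrightarrow> u (left_half m (tjoin a b)) = a"
  by (simp add: tjoin_def left_join u_less u_u)

lemma right_half_tjoin: "b < 2 ^ m \<Longrightarrow> right_half m (tjoin a b) = b"
  by (simp add: tjoin_def right_join)

lemma tjoin_halves: "s < 2 ^ (2 * m) \<Longrightarrow> tjoin (u (left_half m s)) (right_half m s) = s"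
  by (simp add: tjoin_def u_u left_less join_left_right)

lemma tjoin_cases:
  assumes "s < 2 ^ (2 * m)"
  obtains a b where "a < 2 ^ m" "b < 2 ^ m" "s = tjoin a b"
  using assms tjoin_halves u_less left_less right_less by metis

lemma sum_tjoin: "(\<Sum>s<2 ^ (2 * m). f s) = (\<Sum>a<2 ^ m. \<Sum>b<2 ^ m. f (tjoin a b))"
proof -
  have "(\<Sum>a<2 ^ m. g a) = (\<Sum>a<2 ^ m. g (u a))" for g :: "nat \<Rightarrow> 'b::comm_monoid_add"
    by (rule sum.reindex_bij_witness[where i = u and j = u]) (auto simp: u_less u_u)
  then show ?thesis unfolding tjoin_def sum_join .
qed

lemma qform_ising_tjoin:
  fixes D :: "nat \<Rightarrow> nat \<Rightarrow> complex"
  assumes "\<And>a b a' b'. a < 2 ^ m \<Longrightarrow> b < 2 ^ m \<Longrightarrow> a' < 2 ^ m \<Longrightarrow> b' < 2 ^ m \<Longrightarrow>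
      h (tjoin a b) (tjoin a' b') = complex_of_real ((if b = b' then K a a' else 0)
        + (if a = a' then K b b' else 0) - (if a = a' \<and> b = b' then W a b else 0))"
  shows "qform (2 ^ (2 * m)) h (\<lambda>s. D (u (left_half m s)) (right_half m s)) = mirror_form (2 ^ m) K W D"
proof -
  let ?n = "2 ^ m :: nat"
  have "qform (2 ^ (2 * m)) h (\<lambda>s. D (u (left_half m s)) (right_half m s))
      = (\<Sum>a<?n. \<Sum>b<?n. \<Sum>a'<?n. \<Sum>b'<?n. cnj (D a b) * h (tjoin a b) (tjoin a' b') * D a' b')"
    unfolding qform_def sum_tjoin
    by (intro sum.cong refl) (simp add: left_half_tjoin right_half_tjoin)
  also have "\<dots> = (\<Sum>a<?n. \<Sum>b<?n. (\<Sum>a'<?n. K a a' * (cnj (D a b) * D a' b))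
      + (\<Sum>b'<?n. K b b' * (cnj (D a b) * D a b')) - W a b * (cnj (D a b) * D a b))"
  proof (intro sum.cong refl)
    fix a b assume "a \<in> {..<?n}" "b \<in> {..<?n}"
    then have ab: "a < ?n" "b < ?n" by auto
    have "(\<Sum>a'<?n. \<Sum>b'<?n. cnj (D a b) * h (tjoin a b) (tjoin a' b') * D a' b')
      = (\<Sum>a'<?n. \<Sum>b'<?n. (if b' = b then K a a' * (cnj (D a b) * D a' b) else 0)
          + (if a' = a then K b b' * (cnj (D a b) * D a b') else 0)
          - (if b' = b then if a' = a then W a b * (cnj (D a b) * D a b) else 0 else 0))"
      by (intro sum.cong refl) (use ab in \<open>simp add: assms algebra_simps\<close>)
    also have "\<dots> = (\<Sum>a'<?n. K a a' * (cnj (D a b) * D a' b))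
      + (\<Sum>b'<?n. K b b' * (cnj (D a b) * D a b')) - W a b * (cnj (D a b) * D a b)"
    proof -
      have "(\<Sum>a'<?n. \<Sum>b'<?n. if a' = a then K b b' * (cnj (D a b) * D a b') else 0)
          = (\<Sum>b'<?n. K b b' * (cnj (D a b) * D a b'))"
        using ab by (subst sum.swap) simp
      then show ?thesis using ab by (simp add: sum.distrib sum_subtractf)
    qed
    finally show "(\<Sum>a'<?n. \<Sum>b'<?n. cnj (D a b) * h (tjoin a b) (tjoin a' b') * D a' b') = \<dots>" .
  qed
  also have "\<dots> = mirror_form ?n K W D"
  proof -
    have "(\<Sum>a<?n. \<Sum>b<?n. \<Sum>a'<?n. K a a' * (cnj (D a b) * D a' b))
        = (\<Sum>a<?n. \<Sum>a'<?n. K a a' * (\<Sum>b<?n. cnj (D a b) * D a' b))"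
      unfolding sum_distrib_left by (rule sum.cong[OF refl], rule sum.swap)
    moreover have "(\<Sum>a<?n. \<Sum>b<?n. \<Sum>b'<?n. K b b' * (cnj (D a b) * D a b'))
        = (\<Sum>b<?n. \<Sum>b'<?n. K b b' * (\<Sum>a<?n. cnj (D a b) * D a b'))"
      unfolding sum_distrib_left by (subst sum.swap, rule sum.cong[OF refl], rule sum.swap)
    ultimately show ?thesis
      unfolding mirror_form_def sum.distrib sum_subtractf by simp
  qed
  finally show ?thesis .
qed

text \<open>The number \<open>e\<close> is the effect of \<open>u\<close> on the sign of a spin: 1
  for the identity, -1 for the flip. As \<open>u\<close> acts on one half only, a term coupling the
  halves picks up one factor \<open>e\<close>, and \<open>S\<close> says that the resulting coupling
  is negative semi-definite.\<close>

lemma ising_ground_state_positive: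
  assumes g: "nondegenerate_ground_state (ising_hamiltonian (2 * m) J B) \<psi>"
    and J: "\<forall>i \<in> {1..2 * m}. \<forall>j \<in> {1..2 * m}. J i j = J (2 * m + 1 - i) (2 * m + 1 - j)"
    and uK: "\<And>a b. a < 2 ^ m \<Longrightarrow> b < 2 ^ m \<Longrightarrow>
      ising_entry m J B (u a) (u b) = ising_entry m J B a b"
    and uz: "\<And>i a. i \<in> {1..m} \<Longrightarrow> zsign m i (u a) = e * zsign m i a"
    and S: "\<And>x. 0 \<le> (\<Sum>i = 1..m. \<Sum>j = 1..m. - e * J i (2 * m + 1 - j) * (x i * x j))"
  obtains c p v where "cmod c = 1" "orthonormal (2 ^ m) v" "\<And>k. 0 \<le> p k"
    "\<And>a b. a < 2 ^ m \<Longrightarrow> b < 2 ^ m \<Longrightarrow> \<psi> $ tjoin a b = c * spectral_sum (2 ^ m) p v a b"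
proof -
  let ?n = "2 ^ m :: nat" and ?N = "2 ^ (2 * m) :: nat"
  define H where "H = ising_hamiltonian (2 * m) J B"
  define h where "h s t = H $$ (s, t)" for s t
  have H: "H \<in> carrier_mat ?N ?N" unfolding H_def by (rule ising_hamiltonian_carrier)
  have h: "h s t = complex_of_real (ising_entry (2 * m) J B s t)" if "s < ?N" "t < ?N" for s t
    unfolding h_def H_def using that by (rule ising_hamiltonian_entry)
  from g obtain E :: real where norm: "\<psi> \<bullet>c \<psi> = 1" and ev: "eigenvector H \<psi> (complex_of_real E)"
    and low: "\<And>e :: real. eigenvalue H (complex_of_real e) \<Longrightarrow> E \<le> e"
    and uniq: "\<And>\<phi>. eigenvector H \<phi> (complex_of_real E) \<Longrightarrow> \<exists>c. \<phi> = c \<cdot>\<^sub>v \<psi>"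
    unfolding nondegenerate_ground_state_def H_def by blast
  have psi: "\<psi> \<in> carrier_vec ?N" using ev H by (auto simp: eigenvector_def)
  have Hv: "(H *\<^sub>v w) $ i = (\<Sum>j<?N. h i j * w $ j)" if "w \<in> carrier_vec ?N" "i < ?N" for w i
    using that H by (simp add: h_def scalar_prod_def atLeast0LessThan)
  have eigI: "eigenvector H (vec ?N w) (complex_of_real e)"
    if "\<And>i. i < ?N \<Longrightarrow> (\<Sum>j<?N. h i j * w j) = complex_of_real e * w i" "\<exists>i<?N. w i \<noteq> 0" for w e
  proof -
    have "vec ?N w \<noteq> 0\<^sub>v ?N" using that(2) by (metis index_vec index_zero_vec(1))
    moreover have "H *\<^sub>v vec ?N w = complex_of_real e \<cdot>\<^sub>v vec ?N w"
      by (rule eq_vecI) (use H Hv[OF vec_carrier] that(1) in auto)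
    ultimately show ?thesis using H by (simp add: eigenvector_def)
  qed
  have herm: "h t s = cnj (h s t)" if "s < ?N" "t < ?N" for s t
    using that by (simp add: h ising_entry_sym)
  have low': "E \<le> e" if "(\<Sum>i<?N. cnj (w i) * w i) = 1"
    "\<And>i. i < ?N \<Longrightarrow> (\<Sum>j<?N. h i j * w j) = complex_of_real e * w i" for w e
  proof -
    have "\<exists>i<?N. w i \<noteq> 0"
    proof (rule ccontr)
      assume "\<not> ?thesis"
      then have "(\<Sum>i<?N. cnj (w i) * w i) = 0" by simp
      then show False using that(1) by simp
    qed
    then show ?thesis using low eigI[OF that(2)] unfolding eigenvalue_def by blast
  qed
  note var = ground_state_variational[of ?N h E, OF herm low']
  define K where "K = ising_entry m J B"
  define W where "W a b = (\<Sum>i\<in>{1..m}. \<Sum>j\<in>{1..m}. - e * J i (2 * m + 1 - j) *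
    (zsign m i a * zsign m j b + zsign m j a * zsign m i b))" for a b
  \<comment> \<open>Turns a matrix of amplitudes back into a state vector, inverting the reading by
    \<open>tjoin\<close>.\<close>
  define lift where "lift D s = D (u (left_half m s)) (right_half m s)"
    for D :: "nat \<Rightarrow> nat \<Rightarrow> complex" and s
  have hK: "h (tjoin a b) (tjoin a' b') = complex_of_real ((if b = b' then K a a' else 0)
        + (if a = a' then K b b' else 0) - (if a = a' \<and> b = b' then W a b else 0))"
    if "a < ?n" "b < ?n" "a' < ?n" "b' < ?n" for a b a' b'
  proof -
    have uu: "u a = u a' \<longleftrightarrow> a = a'" using that u_u by metis
    have V: "(\<Sum>i = 1..m. \<Sum>j = 1..m. J i (2 * m + 1 - j) *
        (zsign m i (u a) * zsign m j b + zsign m j (u a) * zsign m i b)) = - W a b"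
      by (simp add: W_def uz algebra_simps flip: sum_negf)
    have "ising_entry (2 * m) J B (tjoin a b) (tjoin a' b') = (if b = b' then K a a' else 0)
        + (if a = a' then K b b' else 0) - (if a = a' \<and> b = b' then W a b else 0)"
      unfolding tjoin_def K_def
        ising_entry_join[OF J u_less[OF that(1)] that(2) u_less[OF that(3)] that(4)]
        V uu uK[OF that(1,3)] by auto
    then show ?thesis unfolding h[OF tjoin_less tjoin_less] by (simp only:)
  qed
  have q: "qform ?N h (lift D) = mirror_form ?n K W D" for D
    unfolding lift_def[abs_def] by (rule qform_ising_tjoin) (rule hK)
  have nrm: "(\<Sum>s<?N. (cmod (lift D s))\<^sup>2) = (\<Sum>a<?n. \<Sum>b<?n. (cmod (D a b))\<^sup>2)" for D
    unfolding sum_tjoin lift_def by (intro sum.cong refl) (simp add: left_half_tjoin right_half_tjoin)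
  define C where "C a b = \<psi> $ tjoin a b" for a b
  have liftC: "lift C s = \<psi> $ s" if "s < ?N" for s
    using that by (simp add: lift_def C_def tjoin_halves)
  have C1: "(\<Sum>a<?n. \<Sum>b<?n. (cmod (C a b))\<^sup>2) = 1"
  proof -
    have "complex_of_real (\<Sum>s<?N. (cmod (\<psi> $ s))\<^sup>2) = \<psi> \<bullet>c \<psi>"
      unfolding of_real_sum complex_norm_square using psi
      by (simp add: scalar_prod_def atLeast0LessThan)
    then have "(\<Sum>s<?N. (cmod (\<psi> $ s))\<^sup>2) = 1" unfolding norm by (metis of_real_eq_1_iff)
    then show ?thesis unfolding nrm[symmetric] by (simp add: liftC)
  qed
  have "(\<Sum>j<?N. h i j * \<psi> $ j) = complex_of_real E * \<psi> $ i" if "i < ?N" for i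
    using ev Hv[OF psi that] that psi by (simp add: eigenvector_def)
  then have "qform ?N h (lift C) = complex_of_real E * (\<Sum>i<?N. cnj (lift C i) * lift C i)"
    by (intro qform_eigenvector) (simp add: liftC)
  then have CE: "Re (mirror_form ?n K W C) = E"
    unfolding q sum_cnj_mult_self nrm C1 by simp
  show thesis
  proof (rule ground_state_positive_up_to_phase[where n = ?n and K = K and W = W and E = E and C = C
        and I = "{1..m}" and S = "\<lambda>i j. - e * J i (2 * m + 1 - j)" and z = "zsign m"])
    show "K a b = K b a" for a b unfolding K_def by (rule ising_entry_sym)
    show "W a b = (\<Sum>i\<in>{1..m}. \<Sum>j\<in>{1..m}. - e * J i (2 * m + 1 - j) *
      (zsign m i a * zsign m j b + zsign m j a * zsign m i b))" for a b by (rule W_def)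
    show "0 \<le> (\<Sum>i\<in>{1..m}. \<Sum>j\<in>{1..m}. - e * J i (2 * m + 1 - j) * (x i * x j))" for x by (rule S)
    show "E * (\<Sum>a<?n. \<Sum>b<?n. (cmod (D a b))\<^sup>2) \<le> Re (mirror_form ?n K W D)" for D
      using var(1)[where f = "lift D"] unfolding q nrm .
    show "\<exists>c. \<forall>a<?n. \<forall>b<?n. D a b = c * C a b"
      if eq: "Re (mirror_form ?n K W D) = E * (\<Sum>a<?n. \<Sum>b<?n. (cmod (D a b))\<^sup>2)" for D
    \<comment> \<open>Eigenvectors are non-zero by definition, so the zero matrix is treated apart,
      with factor 0.\<close>
    proof (cases "\<exists>s<?N. lift D s \<noteq> 0")
      case True
      have "(\<Sum>t<?N. h s t * lift D t) = complex_of_real E * lift D s" if "s < ?N" for s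
        using var(2)[where f = "lift D" and i = s] eq that unfolding q nrm by simp
      from eigI[OF this True] obtain c where c: "vec ?N (lift D) = c \<cdot>\<^sub>v \<psi>" using uniq by blast
      have "D a b = c * C a b" if "a < ?n" "b < ?n" for a b
      proof -
        have "vec ?N (lift D) $ tjoin a b = c * \<psi> $ tjoin a b"
          unfolding c using psi tjoin_less by simp
        then show ?thesis
          using that by (simp add: tjoin_less lift_def left_half_tjoin right_half_tjoin C_def)
      qed
      then show ?thesis by blast
    next
      case False
      have "D a b = 0" if "a < ?n" "b < ?n" for a b
        using False tjoin_less that unfolding lift_def
        by (metis left_half_tjoin right_half_tjoin)
      then show ?thesis by (intro exI[of _ 0]) simp
    qed
    show "Re (mirror_form ?n K W C) = E" by (rule CE)
    show "(\<Sum>a<?n. \<Sum>b<?n. (cmod (C a b))\<^sup>2) = 1" by (rule C1)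
    fix c p v assume "cmod c = 1" "orthonormal ?n v" "\<And>k. 0 \<le> p k"
      "\<And>a b. a < ?n \<Longrightarrow> b < ?n \<Longrightarrow> C a b = c * spectral_sum ?n p v a b"
    then show thesis using that unfolding C_def by blast
  qed
qed

text \<open>Row \<open>tjoin a b\<close> of \<open>X\<close> is row \<open>tjoin b a\<close> of
  \<open>R\<close>, where \<open>R\<close> is \<open>P \<otimes> P\<close> with both factors
  transposed. Thus \<open>X\<close> is a permutation times \<open>R\<close>, so \<open>X\<close> and
  \<open>R\<close> have the same product of adjoint and matrix. As \<open>R\<close> is positive
  semi-definite, it is the modulus of \<open>X\<close>, and its trace is the square of the trace of
  \<open>P\<close>.\<close>

lemma trace_norm_partial_transpose:
  assumes psi: "\<psi> \<in> carrier_vec (2 ^ (2 * m))"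
    and c: "cmod c = 1" and v: "orthonormal (2 ^ m) v" and p: "\<And>k. 0 \<le> p k"
    and polar: "\<And>a b. a < 2 ^ m \<Longrightarrow> b < 2 ^ m \<Longrightarrow>
      \<psi> $ tjoin a b = c * spectral_sum (2 ^ m) p v a b"
  shows "trace_norm (partial_transpose (2 * m) {1..m} (ket_bra \<psi> \<psi>)) = (\<Sum>k<2 ^ m. p k)\<^sup>2"
proof -
  let ?n = "2 ^ m :: nat" and ?N = "2 ^ (2 * m) :: nat"
  define P where "P = spectral_sum ?n p v"
  define X where "X = partial_transpose (2 * m) {1..m} (ket_bra \<psi> \<psi>)"
  define R where "R = mat ?N ?N (\<lambda>(s, t). P (u (left_half m t)) (u (left_half m s)) *
    P (right_half m t) (right_half m s))"
  have X: "X \<in> carrier_mat ?N ?N" by (simp add: X_def partial_transpose_def)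
  have R: "R \<in> carrier_mat ?N ?N" by (simp add: R_def)
  have cnjP: "cnj (P a b) = P b a" for a b unfolding P_def by (rule cnj_spectral_sum)
  \<comment> \<open>The phase cancels between ket and bra.\<close>
  have cc: "c * cnj c = 1" using c by (metis complex_norm_square of_real_1 one_power2)
  have Xe: "X $$ (tjoin a b, tjoin a' b') = P a' b * P b' a"
    if "a < ?n" "b < ?n" "a' < ?n" "b' < ?n" for a b a' b'
  proof -
    have "X $$ (tjoin a b, tjoin a' b') = \<psi> $ tjoin a' b * cnj (\<psi> $ tjoin a b')"
      using psi by (simp add: X_def partial_transpose_def ket_bra_def tjoin_less del: One_nat_def)
        (simp add: tjoin_def splice_index_join join_less del: One_nat_def)
    also have "\<dots> = (c * cnj c) * (P a' b * cnj (P a b'))"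
      using that by (simp add: polar P_def)
    finally show ?thesis by (simp add: cc cnjP)
  qed
  have Re: "R $$ (tjoin a b, tjoin a' b') = P a' a * P b' b"
    if "a < ?n" "b < ?n" "a' < ?n" "b' < ?n" for a b a' b'
    using that by (simp add: R_def tjoin_less left_half_tjoin right_half_tjoin)
  have "R * R = mat_adjoint X * X"
  proof (rule eq_matI)
    fix s t assume "s < dim_row (mat_adjoint X * X)" "t < dim_col (mat_adjoint X * X)"
    then have st: "s < ?N" "t < ?N" using X by (auto simp: mat_adjoint_def)
    have adj: "mat_adjoint X \<in> carrier_mat ?N ?N" using X by (auto simp: mat_adjoint_def)
    obtain a b where a: "a < ?n" "b < ?n" "s = tjoin a b" using st(1) by (rule tjoin_cases)
    obtain a' b' where a': "a' < ?n" "b' < ?n" "t = tjoin a' b'" using st(2) by (rule tjoin_cases)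
    have "(R * R) $$ (s, t) = (\<Sum>e<?n. \<Sum>f<?n. (P e a * P f b) * (P a' e * P b' f))"
      unfolding mat_mult_entries[OF R R st] sum_tjoin using a a' by (simp add: Re)
    \<comment> \<open>Exchanging \<open>e\<close> and \<open>f\<close> is the permutation of the
      rows: from here on they are read as \<open>tjoin f e\<close>.\<close>
    also have "\<dots> = (\<Sum>f<?n. \<Sum>e<?n. cnj (P a e * P b f) * (P a' e * P b' f))"
      by (subst sum.swap) (simp add: cnjP)
    also have "\<dots> = (\<Sum>f<?n. \<Sum>e<?n. mat_adjoint X $$ (s, tjoin f e) * X $$ (tjoin f e, t))"
    proof (intro sum.cong refl)
      fix f e assume "f \<in> {..<?n}" "e \<in> {..<?n}"
      then show "cnj (P a e * P b f) * (P a' e * P b' f)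
          = mat_adjoint X $$ (s, tjoin f e) * X $$ (tjoin f e, t)"
        using a a' unfolding a(3) a'(3) mat_adjoint_entries[OF X tjoin_less tjoin_less]
        by (simp only: Xe lessThan_iff)
    qed
    also have "\<dots> = (mat_adjoint X * X) $$ (s, t)"
      unfolding mat_mult_entries[OF adj X st] sum_tjoin ..
    finally show "(R * R) $$ (s, t) = (mat_adjoint X * X) $$ (s, t)" .
  qed (use X R in \<open>auto simp: mat_adjoint_def\<close>)
  moreover have "pos_semidef R"
    unfolding pos_semidef_iff_qform[OF R]
  proof
    fix w
    \<comment> \<open>The index \<open>q\<close> enumerates pairs of eigenvector labels through its
      two halves; these are labels and not spin configurations, so \<open>u\<close> does not act on
      them. The products of eigenvectors are conjugated because \<open>R\<close> contains the
      transposes of \<open>P\<close>.\<close>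
    have "qform ?N (\<lambda>i j. R $$ (i, j)) w = complex_of_real (\<Sum>q<?N.
        (p (left_half m q) * p (right_half m q)) * (cmod (\<Sum>j<?N.
          cnj (cnj (v (left_half m q) (u (left_half m j))) * cnj (v (right_half m q) (right_half m j))) * w j))\<^sup>2)"
    proof (rule qform_spectral)
      fix s t assume st: "s < ?N" "t < ?N"
      have "R $$ (s, t) = (\<Sum>k<?n. \<Sum>l<?n.
          (p k * v k (u (left_half m t)) * cnj (v k (u (left_half m s)))) *
          (p l * v l (right_half m t) * cnj (v l (right_half m s))))"
        using st by (simp add: R_def P_def spectral_sum_def sum_product)
      then show "R $$ (s, t) = (\<Sum>q<?N. complex_of_real (p (left_half m q) * p (right_half m q)) *
          (cnj (v (left_half m q) (u (left_half m s))) * cnj (v (right_half m q) (right_half m s))) *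
          cnj (cnj (v (left_half m q) (u (left_half m t))) * cnj (v (right_half m q) (right_half m t))))"
        unfolding sum_join by (simp add: left_join right_join mult_ac)
    qed
    also have "0 \<le> \<dots>"
      by (simp add: less_eq_complex_def p sum_nonneg)
    finally show "0 \<le> qform ?N (\<lambda>i j. R $$ (i, j)) w" .
  qed
  ultimately have "mat_abs X = R" by (intro mat_abs_eqI[OF X R])
  then have "trace_norm X = Re (\<Sum>s<?N. R $$ (s, s))"
    using R by (simp add: trace_norm_def mat_trace_def)
  also have "(\<Sum>s<?N. R $$ (s, s)) = (\<Sum>a<?n. P a a) * (\<Sum>b<?n. P b b)"
    unfolding sum_tjoin sum_product by (intro sum.cong refl) (simp add: Re)
  also have "\<dots> = complex_of_real ((\<Sum>k<?n. p k)\<^sup>2)"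
    unfolding P_def spectral_sum_trace[OF v] by (simp add: power2_eq_square)
  finally show ?thesis by (simp add: X_def)
qed

text \<open>In the coordinates of \<open>tjoin\<close> the vector \<open>\<phi>\<close> is the
  identity matrix, so its overlap with \<open>\<psi>\<close> is the trace of the amplitude matrix,
  \<open>c\<close> times the sum of the \<open>p k\<close>. That sum is non-zero, since otherwise
  every \<open>p k\<close> and with them \<open>\<psi>\<close> would vanish.\<close>

lemma log_negativity_eq_overlap:
  assumes psi: "\<psi> \<in> carrier_vec (2 ^ (2 * m))" "\<psi> \<bullet>c \<psi> = 1"
    and c: "cmod c = 1" and v: "orthonormal (2 ^ m) v" and p: "\<And>k. 0 \<le> p k"
    and polar: "\<And>a b. a < 2 ^ m \<Longrightarrow> b < 2 ^ m \<Longrightarrow>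
      \<psi> $ tjoin a b = c * spectral_sum (2 ^ m) p v a b"
    and phi: "\<phi> \<in> carrier_vec (2 ^ (2 * m))"
    "\<And>a b. a < 2 ^ m \<Longrightarrow> b < 2 ^ m \<Longrightarrow> \<phi> $ tjoin a b = (if a = b then 1 else 0)"
  shows "0 < Re (mat_trace (ket_bra \<phi> \<phi> * ket_bra \<psi> \<psi>)) \<and>
    log_negativity (2 * m) (ket_bra \<psi> \<psi>) = log 2 (Re (mat_trace (ket_bra \<phi> \<phi> * ket_bra \<psi> \<psi>)))"
proof -
  let ?n = "2 ^ m :: nat" and ?N = "2 ^ (2 * m) :: nat"
  have "(\<Sum>s<?N. cnj (\<phi> $ s) * \<psi> $ s) = (\<Sum>a<?n. \<Sum>b<?n. if b = a then \<psi> $ tjoin a b else 0)"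
    unfolding sum_tjoin using phi(2) by (intro sum.cong refl) simp
  also have "\<dots> = c * (\<Sum>a<?n. spectral_sum ?n p v a a)"
    by (simp add: polar sum_distrib_left)
  also have "\<dots> = c * complex_of_real (\<Sum>k<?n. p k)"
    unfolding spectral_sum_trace[OF v] ..
  finally have ov: "Re (mat_trace (ket_bra \<phi> \<phi> * ket_bra \<psi> \<psi>)) = (\<Sum>k<?n. p k)\<^sup>2"
    unfolding mat_trace_overlap[OF phi(1) psi(1)]
    by (simp add: norm_mult c power_mult_distrib del: of_real_sum)
  have "(\<Sum>k<?n. p k) \<noteq> 0"
  proof
    assume "(\<Sum>k<?n. p k) = 0"
    then have "p k = 0" if "k < ?n" for k
      using that by (subst (asm) sum_nonneg_eq_0_iff) (auto simp: p)
    then have z: "\<psi> $ tjoin a b = 0" if "a < ?n" "b < ?n" for a b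
      using that by (simp add: polar spectral_sum_def)
    have "\<psi> \<bullet>c \<psi> = (\<Sum>s<?N. \<psi> $ s * cnj (\<psi> $ s))"
      using psi(1) by (simp add: scalar_prod_def atLeast0LessThan)
    also have "\<dots> = 0" unfolding sum_tjoin by (simp add: z)
    finally show False using psi(2) by simp
  qed
  then show ?thesis
    using trace_norm_partial_transpose[OF psi(1) c v p polar]
    by (simp add: ov log_negativity_def)
qed

end

section \<open>Amplitudes of the two reference states\<close>

lemma Phi_carrier: "Phi N \<in> carrier_vec (2 ^ N)"
  by (simp add: Phi_def)

text \<open>The factor \<open>2 powr (real N / 4)\<close> is \<open>sqrt 2 ^ m\<close> for
  \<open>N = 2 * m\<close> and cancels the normalisations of the \<open>m\<close> Bell pairs
  exactly.\<close>

lemma Phi_entry: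
  assumes "a < 2 ^ m" "b < 2 ^ m"
  shows "Phi (2 * m) $ mirror_join m a b = (if a = b then 1 else 0)"
proof -
  have "(\<Prod>i = 1..m. bell (spin (2 * m) i (mirror_join m a b)) (spin (2 * m) (2 * m + 1 - i) (mirror_join m a b)))
      = (\<Prod>i = 1..m. if spin m i a = spin m i b then complex_of_real (1 / sqrt 2) else 0)"
    by (intro prod.cong refl) (simp only: spin_join bell_def)
  also have "\<dots> = (if a = b then complex_of_real (1 / sqrt 2) ^ m else 0)"
    unfolding eq_iff_spins_eq[OF assms] by auto
  finally have "Phi (2 * m) $ mirror_join m a b
      = (if a = b then complex_of_real (2 powr (real m / 2) * (1 / sqrt 2) ^ m) else 0)"
    by (simp add: Phi_def join_less del: One_nat_def)
  moreover have "2 powr (real m / 2) * (1 / sqrt 2) ^ m = (1 :: real)"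
  proof -
    have "2 powr (real m / 2) = sqrt 2 ^ m"
      by (simp add: powr_half_sqrt[symmetric] powr_powr flip: powr_realpow)
    then show ?thesis by (simp add: power_divide)
  qed
  ultimately show ?thesis by simp
qed

lemma Phi'_carrier: "Phi' N \<in> carrier_vec (2 ^ N)"
  unfolding Phi'_def by (rule mult_mat_vec_carrier[OF _ Phi_carrier]) (simp add: tensor_op_def)

text \<open>Flipping the first half moves the non-zero amplitudes from the diagonal to the
  complementary rows; relabelling rows by \<open>complement\<close> makes this the identity matrix
  again.\<close>

lemma Phi'_entry:
  assumes "a < 2 ^ m" "b < 2 ^ m"
  shows "Phi' (2 * m) $ mirror_join m a b = (if b = complement m a then 1 else 0)"
proof -
  let ?M = "\<lambda>i. if i \<le> m then pauli_x else 1\<^sub>m 2"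
  have T: "tensor_op (2 * m) ?M $$ (mirror_join m a b, mirror_join m a' b')
      = (if a' = complement m a \<and> b' = b then 1 else 0)" if "a' < 2 ^ m" "b' < 2 ^ m" for a' b'
  proof -
    have "tensor_op m ?M $$ (a, a') = (if a' = complement m a then 1 else 0)"
      by (rule tensor_op_pauli_x) (use assms that in auto)
    moreover have "tensor_op m (\<lambda>i. ?M (2 * m + 1 - i)) $$ (b, b') = (if b = b' then 1 else 0)"
      by (rule tensor_op_one) (use assms that in auto)
    ultimately show ?thesis unfolding tensor_op_join[OF assms that] by auto
  qed
  have "Phi' (2 * m) $ mirror_join m a b
      = (\<Sum>t<2 ^ (2 * m). tensor_op (2 * m) ?M $$ (mirror_join m a b, t) * Phi (2 * m) $ t)"
    using Phi_carrier[of "2 * m"]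
    by (simp add: Phi'_def tensor_op_def scalar_prod_def join_less atLeast0LessThan)
  also have "\<dots> = (\<Sum>a'<2 ^ m. \<Sum>b'<2 ^ m. if b' = b then
      (if a' = complement m a then (if b = complement m a then 1 else 0) else 0) else 0)"
    unfolding sum_join by (intro sum.cong refl) (auto simp: T Phi_entry)
  finally show ?thesis using assms complement_less by simp
qed

text \<open>Transfers semi-definiteness from vectors indexed from 0 to sums over sites numbered from
  1.\<close>

lemma cross_coupling_form:
  assumes "A = cross_coupling (2 * m) J"
  shows "\<exists>v \<in> carrier_vec (dim_row A).
    (A *\<^sub>v v) \<bullet>c v = (\<Sum>i = 1..m. \<Sum>j = 1..m. J i (2 * m + 1 - j) * (x i * x j))"
proof -
  \<comment> \<open>Site \<open>i + 1\<close> sits at index \<open>i\<close>, so the column entry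
    \<open>2 * m - j\<close> at index \<open>j\<close> is the mirror image of site
    \<open>j + 1\<close>.\<close>
  define v where "v = vec m (\<lambda>i. x (Suc i))"
  have sh: "(\<Sum>i = 1..m. f i) = (\<Sum>i<m. f (Suc i))" for f :: "nat \<Rightarrow> real"
    by (rule sum.reindex_bij_witness[where i = Suc and j = "\<lambda>i. i - 1"]) auto
  have "(A *\<^sub>v v) \<bullet>c v = (\<Sum>i<m. (\<Sum>j<m. J (i + 1) (2 * m - j) * x (Suc j)) * x (Suc i))"
    by (simp add: assms cross_coupling_def v_def scalar_prod_def atLeast0LessThan)
  also have "\<dots> = (\<Sum>i = 1..m. \<Sum>j = 1..m. J i (2 * m + 1 - j) * (x i * x j))"
    unfolding sh by (simp add: sum_distrib_left mult_ac)
  finally show ?thesis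
    by (intro bexI[of _ v]) (simp_all add: assms cross_coupling_def v_def)
qed

text \<open>The positivity conjuncts ensure that each logarithm of an overlap is taken at a positive
  argument, where \<open>log\<close> has its usual meaning.\<close>

theorem corollary1:
  fixes N :: nat and J :: "nat \<Rightarrow> nat \<Rightarrow> real" and B :: real and \<psi> :: "complex vec"
  assumes "even N" and "N > 0"
    and "nondegenerate_ground_state (ising_hamiltonian N J B) \<psi>"
    and "\<forall>i \<in> {1..N}. \<forall>j \<in> {1..N}. J i j = J (N + 1 - i) (N + 1 - j)"
  shows "(neg_semidef (cross_coupling N J) \<longrightarrow>
            0 < Re (mat_trace (ket_bra (Phi N) (Phi N) * ket_bra \<psi> \<psi>)) \<and>
            log_negativity N (ket_bra \<psi> \<psi>) =
              log 2 (Re (mat_trace (ket_bra (Phi N) (Phi N) * ket_bra \<psi> \<psi>)))) \<and>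
         (pos_semidef (cross_coupling N J) \<longrightarrow>
            0 < Re (mat_trace (ket_bra (Phi' N) (Phi' N) * ket_bra \<psi> \<psi>)) \<and>
            log_negativity N (ket_bra \<psi> \<psi>) =
              log 2 (Re (mat_trace (ket_bra (Phi' N) (Phi' N) * ket_bra \<psi> \<psi>))))"
proof -
  obtain m where N: "N = 2 * m" using assms(1) by blast
  note g = assms(3)[unfolded N] and J = assms(4)[unfolded N]
  have psi: "\<psi> \<in> carrier_vec (2 ^ (2 * m))" "\<psi> \<bullet>c \<psi> = 1"
    using g ising_hamiltonian_carrier[of "2 * m" J B]
    by (auto simp: nondegenerate_ground_state_def eigenvector_def)
  let ?q = "\<lambda>x. \<Sum>i = 1..m. \<Sum>j = 1..m. J i (2 * m + 1 - j) * (x i * x j)"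
  show ?thesis
    unfolding N
  \<comment> \<open>The instantiation restricts \<open>conjI\<close> to the conjunction of the two
    implications; the conjunctions inside them stay whole.\<close>
  proof (intro conjI[of "_ \<longrightarrow> _" "_ \<longrightarrow> _"] impI)
    assume "neg_semidef (cross_coupling (2 * m) J)"
    then have q: "?q x \<le> 0" for x
      using cross_coupling_form[OF refl, of m J x] unfolding neg_semidef_def by metis
    interpret half_involution m "\<lambda>a. a" by unfold_locales simp_all
    \<comment> \<open>No flip, so the sign \<open>e\<close> is 1 and the form is minus the cross
      coupling.\<close>
    have S: "0 \<le> (\<Sum>i = 1..m. \<Sum>j = 1..m. - 1 * J i (2 * m + 1 - j) * (x i * x j))" for x
      using q[of x] by (simp add: sum_negf)
    obtain c p v where "cmod c = 1" "orthonormal (2 ^ m) v" "\<And>k. 0 \<le> p k"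
      "\<And>a b. a < 2 ^ m \<Longrightarrow> b < 2 ^ m \<Longrightarrow> \<psi> $ tjoin a b = c * spectral_sum (2 ^ m) p v a b"
      by (rule ising_ground_state_positive[OF g J refl _ S]) (simp, blast)
    note polar = this
    show "0 < Re (mat_trace (ket_bra (Phi (2 * m)) (Phi (2 * m)) * ket_bra \<psi> \<psi>)) \<and>
      log_negativity (2 * m) (ket_bra \<psi> \<psi>) =
        log 2 (Re (mat_trace (ket_bra (Phi (2 * m)) (Phi (2 * m)) * ket_bra \<psi> \<psi>)))"
      by (rule log_negativity_eq_overlap[OF psi polar Phi_carrier])
        (auto simp: tjoin_def Phi_entry)
  next
    assume "pos_semidef (cross_coupling (2 * m) J)"
    then have q: "0 \<le> ?q x" for x
      using cross_coupling_form[OF refl, of m J x] unfolding pos_semidef_def by metis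
    interpret half_involution m "complement m"
      by unfold_locales (simp_all add: complement_less complement_complement)
    \<comment> \<open>The flip has sign \<open>e = - 1\<close>, which turns the positive
      semi-definite coupling into a negative one.\<close>
    have S: "0 \<le> (\<Sum>i = 1..m. \<Sum>j = 1..m. - (- 1) * J i (2 * m + 1 - j) * (x i * x j))" for x
      using q[of x] by simp
    obtain c p v where "cmod c = 1" "orthonormal (2 ^ m) v" "\<And>k. 0 \<le> p k"
      "\<And>a b. a < 2 ^ m \<Longrightarrow> b < 2 ^ m \<Longrightarrow> \<psi> $ tjoin a b = c * spectral_sum (2 ^ m) p v a b"
      by (rule ising_ground_state_positive[OF g J _ _ S])
        (simp add: ising_entry_complement, simp add: zsign_complement, blast)
    note polar = this
    show "0 < Re (mat_trace (ket_bra (Phi' (2 * m)) (Phi' (2 * m)) * ket_bra \<psi> \<psi>)) \<and>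
      log_negativity (2 * m) (ket_bra \<psi> \<psi>) =
        log 2 (Re (mat_trace (ket_bra (Phi' (2 * m)) (Phi' (2 * m)) * ket_bra \<psi> \<psi>)))"
      by (rule log_negativity_eq_overlap[OF psi polar Phi'_carrier])
        (auto simp: tjoin_def Phi'_entry complement_less complement_complement)
  qed
qed

end
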